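(* Let $(\tilde s,\theta)$, with $\tilde s=(x,y,z_1,z_2,z_3)\in W^{1,2}([0,t_f];\mathbb{R}^5)$ and $\theta\in L^2([0,t_f];\mathbb{R})$, be an optimal pair for Problem (P1), and let $\tilde\lambda=(\lambda_x,\lambda_y,\lambda_{z_1},\lambda_{z_2},\lambda_{z_3})$ be the associated adjoint variable vector (both defined in the context). Then the optimal control for Problem (P1) is given by $$\theta(t)=\arctan\frac{\lambda_y(t)}{\lambda_x(t)}$$ for a.e. $t\in[0,t_f]$.
   Context: Fix real constants $v>0$ (speed), $t_f>0$ and initial data $x_0,y_0\in\mathbb{R}$. Problem (P1): minimize $\tilde\varphi(\tilde s(t_f)) := z_3(t_f)^2 - z_1(t_f)\,z_2(t_f)$ over all pairs $(\tilde s,\theta)$ with state $\tilde s=(x,y,z_1,z_2,z_3)\in W^{1,2}([0,t_f];\mathbb{R}^5)$ and control $\theta\in L^2([0,t_f];\mathbb{R})$ (unconstrained) satisfying, for a.e. $t\in[0,t_f]$, $$\dot x = v\cos\theta,\quad \dot y = v\sin\theta,\quad \dot z_1=\frac{x^2}{(x^2+y^2)^2},\quad \dot z_2=\frac{y^2}{(x^2+y^2)^2},\quad \dot z_3=\frac{xy}{(x^2+y^2)^2},$$ $$x(0)=x_0,\quad y(0)=y_0,\quad z_1(0)=z_2(0)=z_3(0)=0 .$$ A pair is optimal if it is feasible and attains the minimum of $\tilde\varphi(\tilde s(t_f))$ among all feasible pairs. Hamiltonian: $$\tilde H(\tilde s,\theta,\tilde\lambda)=\lambda_x v\cos\theta+\lambda_y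 v\sin\theta+\lambda_{z_1}\frac{x^2}{(x^2+y^2)^2}+\lambda_{z_2}\frac{y^2}{(x^2+y^2)^2}+\lambda_{z_3}\frac{xy}{(x^2+y^2)^2}.$$ Adjoint variable vector: given $(\tilde s,\theta)$, $\tilde\lambda:[0,t_f]\to\mathbb{R}^5$ is the (continuous) solution of $\dot{\tilde\lambda}(t)=-\partial\tilde H/\partial\tilde s\,(\tilde s(t),\theta(t),\tilde\lambda(t))$, $\tilde\lambda(t_f)=\partial\tilde\varphi/\partial\tilde s\,(\tilde s(t_f))$. Explicitly, with $\bar z_i:=z_i(t_f)$: $\lambda_{z_1}\equiv-\bar z_2$, $\lambda_{z_2}\equiv-\bar z_1$, $\lambda_{z_3}\equiv 2\bar z_3$, and $$\dot\lambda_x=\frac{-2\bar z_2x^3+6\bar z_3x^2y+2(\bar z_2-2\bar z_1)xy^2-2\bar z_3y^3}{(x^2+y^2)^3},\quad \lambda_x(t_f)=0,$$ $$\dot\lambda_y=\frac{-2\bar z_1y^3+6\bar z_3y^2x+2(\bar z_1-2\bar z_2)yx^2-2\bar z_3x^3}{(x^2+y^2)^3},\quad \lambda_y(t_f)=0.$$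
   Formalization: The equality θ = arctan(λ_y/λ_x) is stated up to an integer multiple of π (depending on t), since θ+2π is optimal with the same adjoint and so the principal value cannot hold for every optimal control; λ_x(t) ≠ 0 a.e. is also proved. *)

theory Defs
  imports "HOL-Analysis.Analysis"
begin

definition L2_on :: "real \<Rightarrow> real \<Rightarrow> (real \<Rightarrow> 'a::euclidean_space) \<Rightarrow> bool" where
  "L2_on a b f \<longleftrightarrow>
     f \<in> borel_measurable (lebesgue_on {a..b}) \<and>
     integrable (lebesgue_on {a..b}) (\<lambda>t. (norm (f t))\<^sup>2)"

(* A class in W^{1,2}([a,b]) is identified with its absolutely continuous representative f;
   its derivative f' is determined up to null sets. *)
definition has_W12_deriv ::
    "real \<Rightarrow> real \<Rightarrow> (real \<Rightarrow> 'a::euclidean_space) \<Rightarrow> (real \<Rightarrow> 'a) \<Rightarrow> bool" where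
  "has_W12_deriv a b f f' \<longleftrightarrow>
     L2_on a b f' \<and> (\<forall>t\<in>{a..b}. (f' has_integral (f t - f a)) {a..t})"

(* The components 1,...,5 of the state are x, y, z1, z2, z3.
   The value 0 that the last three components of the right-hand side get at x = y = 0 is
   immaterial: for v > 0, a trajectory in W^{1,2} satisfying the equations almost everywhere
   cannot pass through the origin, since r <= v |t - t0| would make z1' + z2' = 1 / r^2
   non-integrable near the time t0 of passage. *)
definition dynamics :: "real \<Rightarrow> real^5 \<Rightarrow> real \<Rightarrow> real^5" where
  "dynamics v s \<theta> = (let x = s $ 1; y = s $ 2; r4 = (x\<^sup>2 + y\<^sup>2)\<^sup>2 in
     vector [v * cos \<theta>, v * sin \<theta>, x\<^sup>2 / r4, y\<^sup>2 / r4, x * y / r4])"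

definition feasible ::
    "real \<Rightarrow> real \<Rightarrow> real \<Rightarrow> real \<Rightarrow> (real \<Rightarrow> real^5) \<Rightarrow> (real \<Rightarrow> real) \<Rightarrow> bool" where
  "feasible v tf x0 y0 s \<theta> \<longleftrightarrow>
     L2_on 0 tf \<theta> \<and>
     (\<exists>s'. has_W12_deriv 0 tf s s' \<and>
           (AE t in lebesgue_on {0..tf}. s' t = dynamics v (s t) (\<theta> t))) \<and>
     s 0 = vector [x0, y0, 0, 0, 0]"

definition terminal_cost :: "real^5 \<Rightarrow> real" where
  "terminal_cost s = (s $ 5)\<^sup>2 - s $ 3 * s $ 4"

definition optimal_pair ::
    "real \<Rightarrow> real \<Rightarrow> real \<Rightarrow> real \<Rightarrow> (real \<Rightarrow> real^5) \<Rightarrow> (real \<Rightarrow> real) \<Rightarrow> bool" where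
  "optimal_pair v tf x0 y0 s \<theta> \<longleftrightarrow>
     feasible v tf x0 y0 s \<theta> \<and>
     (\<forall>s' \<theta>'. feasible v tf x0 y0 s' \<theta>' \<longrightarrow> terminal_cost (s tf) \<le> terminal_cost (s' tf))"

definition hamiltonian :: "real \<Rightarrow> real^5 \<Rightarrow> real \<Rightarrow> real^5 \<Rightarrow> real" where
  "hamiltonian v s \<theta> p = p \<bullet> dynamics v s \<theta>"

(* The partial gradient of the Hamiltonian in the state does not involve the control and is
   continuous away from x = y = 0, so the adjoint equation is imposed at every time. *)
definition is_adjoint ::
    "real \<Rightarrow> real \<Rightarrow> (real \<Rightarrow> real^5) \<Rightarrow> (real \<Rightarrow> real) \<Rightarrow> (real \<Rightarrow> real^5) \<Rightarrow> bool" where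
  "is_adjoint v tf s \<theta> p \<longleftrightarrow>
     (\<forall>t\<in>{0..tf}. \<exists>D. (GDERIV (\<lambda>\<sigma>. hamiltonian v \<sigma> (\<theta> t) (p t)) (s t) :> D) \<and>
                      (p has_vector_derivative - D) (at t within {0..tf})) \<and>
     (GDERIV terminal_cost (s tf) :> p tf)"

end

(* Identify the plane with the complex numbers, z = x + iy. With w = 1/z the running costs are
   x^2/r^4 = (Re w)^2, y^2/r^4 = (Im w)^2 and xy/r^4 = - Re w Im w, so the state-dependent part L of
   the Hamiltonian is a quadratic form in w, and l = lambda_x + i lambda_y solves l' = - grad L(z).

   A needle variation towards the minimizer of the Hamiltonian on an interval of length h changes the
   cost by the integral of the decrease of the Hamiltonian up to O(h^2). A function whose increments
   are O(h^2) is constant, so exp(i theta) = - l/|l| almost everywhere where l does not vanish.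

   A straight line has negative cost by the strict Cauchy-Schwarz inequality; hence the optimal cost is
   negative and L is negative definite. As L is homogeneous of degree -2, grad L does not vanish, so
   the zeros of l are isolated. If lambda_x vanished at uncountably many points, then at one of them
   the numerator of lambda_x' (a cubic form in x, y) and its y-derivatives would vanish, since x' = 0
   and y' is nonzero there. This forces z3(tf) = 0 and x = lambda_x = 0 at that point, and local
   uniqueness of extremals on the y-axis then gives x = 0 throughout, contradicting z1(tf) > 0. *)

theory Submission
  imports Defs "HOL-Complex_Analysis.Cauchy_Integral_Theorem"
begin

section \<open>Preliminaries on null sets and derivatives\<close>

text \<open>The formula is read modulo pi. The dynamics see \<open>\<theta>\<close> only through
  \<open>cis \<theta>\<close>, and the minimizing direction is opposite to the adjoint vector: where
  lambda_x > 0, the cosine of the control is negative almost everywhere, while angles given by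
  \<open>arctan\<close> have positive cosine, so the multiple of pi is odd there. The control is
  merely square integrable, so the needle estimate is made uniform over all short intervals, which
  replaces an appeal to Lebesgue points. The terminal cost is a quadratic polynomial in the three
  final values; its expansion is exact, and its linear coefficients are the constant multipliers.
  Eliminating the control leaves z' = - v l/|l|, l' = - grad L(z). The right-hand side is
  discontinuous at l = 0, where standard uniqueness fails; since the gradient is nonzero, |l| grows
  linearly there, which is enough for a contraction. An uncountable set of reals contains
  uncountably many of its own limit points, so an identity on it can be differentiated repeatedly
  without analyticity of the trajectory.\<close>

lemma AE_lebesgue_on_iff_negligible:
  assumes "S \<in> sets lebesgue"
  shows "(AE x in lebesgue_on S. P x) \<longleftrightarrow> negligible {x \<in> S. \<not> P x}"
proof -
  have "(AE x in lebesgue_on S. P x) \<longleftrightarrow> (AE x in lebesgue. x \<in> S \<longrightarrow> P x)"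
    using assms by (simp add: AE_restrict_space_iff)
  also have "\<dots> \<longleftrightarrow> {x. \<not> (x \<in> S \<longrightarrow> P x)} \<in> null_sets lebesgue"
  proof
    assume "AE x in lebesgue. x \<in> S \<longrightarrow> P x"
    then obtain N where N: "{x. \<not> (x \<in> S \<longrightarrow> P x)} \<subseteq> N" "N \<in> null_sets lebesgue"
      by (auto elim!: AE_E simp: null_sets_def)
    then show "{x. \<not> (x \<in> S \<longrightarrow> P x)} \<in> null_sets lebesgue"
      using negligible_subset[of N] by (simp add: negligible_iff_null_sets)
  qed (auto intro: AE_I' )
  finally show ?thesis
    by (simp add: negligible_iff_null_sets)
qed

lemma countable_imp_negligible:
  fixes S :: "'a::euclidean_space set"
  shows "countable S \<Longrightarrow> negligible S"
  by (simp add: negligible_iff_null_sets countable_imp_null_set_lborel null_sets_completionI)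

text \<open>Each isolated point is the only point of \<open>E\<close> in some member of a countable
  base, and that member determines it.\<close>

lemma countable_isolated_points:
  fixes E :: "'a::second_countable_topology set"
  shows "countable {t \<in> E. \<not> t islimpt E}"
proof -
  obtain B :: "'a set set" where B: "countable B" "\<And>S. open S \<Longrightarrow> \<exists>U\<subseteq>B. S = \<Union>U"
    using univ_second_countable by metis
  have "{t \<in> E. \<not> t islimpt E} \<subseteq> (\<lambda>b. the_elem (b \<inter> E)) ` B"
  proof
    fix t assume "t \<in> {t \<in> E. \<not> t islimpt E}"
    then have t: "t \<in> E" "\<not> t islimpt E" by auto
    obtain T where T: "t \<in> T" "open T" "\<forall>y\<in>E. y \<in> T \<longrightarrow> y = t"
      using t(2) unfolding islimpt_def by blast
    obtain U where U: "U \<subseteq> B" "T = \<Union>U"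
      using B(2)[OF T(2)] by blast
    then obtain b where b: "b \<in> B" "t \<in> b" "b \<subseteq> T"
      using T(1) by blast
    then have "b \<inter> E = {t}" using T(3) t(1) by blast
    then show "t \<in> (\<lambda>b. the_elem (b \<inter> E)) ` B"
      using b(1) by (intro image_eqI[of _ _ b]) simp_all
  qed
  then show ?thesis
    by (rule countable_subset) (simp add: B(1))
qed

text \<open>Allows an identity that holds only on \<open>E\<close> to be differentiated at limit
  points of \<open>E\<close>: taken along \<open>E\<close>, the rescaled remainder of the linear
  approximation has constant norm \<open>norm D\<close>.\<close>

lemma vector_derivative_zero_at_limit_of_zeros:
  assumes "(f has_vector_derivative D) (at t within T)" "t islimpt E" "E \<subseteq> T" "f t = 0"
    and "\<And>u. u \<in> E \<Longrightarrow> f u = 0"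
  shows "D = 0"
proof -
  have ev: "eventually (\<lambda>u. u \<in> E \<and> u \<noteq> t) (at t within E)"
    by (simp add: eventually_at_filter)
  have "(f has_vector_derivative D) (at t within E)"
    using assms(1,3) has_vector_derivative_within_subset by blast
  then have "((\<lambda>u. (1 / norm (u - t)) *\<^sub>R (f u - (f t + (u - t) *\<^sub>R D))) \<longlongrightarrow> 0) (at t within E)"
    by (simp only: has_vector_derivative_def has_derivative_within)
  then have "((\<lambda>u. norm ((1 / norm (u - t)) *\<^sub>R (f u - (f t + (u - t) *\<^sub>R D)))) \<longlongrightarrow> 0) (at t within E)"
    by (rule tendsto_norm_zero)
  moreover have "eventually (\<lambda>u. norm ((1 / norm (u - t)) *\<^sub>R (f u - (f t + (u - t) *\<^sub>R D))) = norm D)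
      (at t within E)"
    using ev by eventually_elim (simp add: assms)
  ultimately have "((\<lambda>u. norm D) \<longlongrightarrow> 0) (at t within E)"
    by (rule Lim_transform_eventually)
  then show ?thesis
    using assms(2) by (simp add: trivial_limit_within tendsto_const_iff)
qed

text \<open>If all these integrals vanished, Henstock's lemma would give a tagged division whose sum
  of \<open>measure lborel k * norm (f x)\<close> is below \<open>v * T\<close>, yet this sum equals
  \<open>v * T\<close>. Excludes a trajectory that rests at the origin.\<close>

lemma constant_norm_integral_nonzero:
  fixes f :: "real \<Rightarrow> 'a::euclidean_space"
  assumes "T > 0" "\<And>t. norm (f t) = v" "v > 0"
  shows "\<exists>t\<in>{0..T}. \<not> (f has_integral 0) {0..t}"
proof (rule ccontr)
  assume "\<not> ?thesis"
  then have z: "(f has_integral 0) {0..t}" if "t \<in> {0..T}" for t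
    using that by blast
  have int: "f integrable_on cbox 0 T"
    using z[of T] assms(1) by auto
  have z2: "integral {a..b} f = 0" if "0 \<le> a" "a \<le> b" "b \<le> T" for a b
    using Henstock_Kurzweil_Integration.integral_combine[of 0 a b f] that z[of a] z[of b]
    by (auto simp: integral_unique integrable_on_def)
  have pos: "v * T > 0" using assms by simp
  obtain \<gamma> where \<gamma>: "gauge \<gamma>"
    "\<And>p. \<lbrakk>p tagged_partial_division_of (cbox 0 T); \<gamma> fine p\<rbrakk> \<Longrightarrow>
             sum (\<lambda>(x,k). norm (measure lborel k *\<^sub>R f x - integral k f)) p < v * T"
    using Henstock_lemma[OF int pos] by blast
  obtain p where p: "p tagged_division_of (cbox 0 T)" "\<gamma> fine p"
    using fine_division_exists[OF \<gamma>(1)] by blast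
  have "sum (\<lambda>(x,k). norm (measure lborel k *\<^sub>R f x - integral k f)) p = (\<Sum>(x,k)\<in>p. measure lborel k * v)"
  proof (rule sum.cong[OF refl], clarify)
    fix x k assume "(x, k) \<in> p"
    then obtain a b where k: "k = cbox a b" "k \<subseteq> cbox 0 T" "x \<in> k"
      using p(1) by (meson tagged_division_ofD)
    then have "a \<le> b" "0 \<le> a" "b \<le> T" by auto
    then show "norm (measure lborel k *\<^sub>R f x - integral k f) = measure lborel k * v"
      using z2[of a b] k(1) assms(2)[of x] by simp
  qed
  also have "\<dots> = T * v"
    using additive_content_tagged_division[OF p(1)] assms(1)
    by (simp add: sum_distrib_right[symmetric] case_prod_unfold)
  finally show False
    using \<gamma>(2)[of p] p by (simp add: tagged_division_of_def mult.commute)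
qed

lemma negligible_nonzero_if_integral_0:
  fixes g :: "real \<Rightarrow> real"
  assumes g: "(g has_integral 0) S" and S: "S \<in> sets lebesgue" and nn: "\<And>t. t \<in> S \<Longrightarrow> 0 \<le> g t"
  shows "negligible {t \<in> S. g t \<noteq> 0}"
proof -
  have ab: "g absolutely_integrable_on S"
    by (rule nonnegative_absolutely_integrable_1) (use g nn in \<open>auto simp: integrable_on_def\<close>)
  have i0: "integral\<^sup>L lebesgue (\<lambda>t. indicator S t *\<^sub>R g t) = 0"
    using set_lebesgue_integral_eq_integral(2)[OF ab] integral_unique[OF g]
    by (simp add: set_lebesgue_integral_def)
  have "AE t in lebesgue. indicator S t *\<^sub>R g t = 0"
    by (rule integral_nonneg_eq_0_iff_AE[THEN iffD1, OF _ _ i0])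
      (use ab nn in \<open>auto simp: set_integrable_def indicator_def\<close>)
  then have "AE t in lebesgue_on S. g t = 0"
    using S by (simp add: AE_restrict_space_iff) (auto elim!: eventually_mono)
  then show ?thesis
    using S by (simp add: AE_lebesgue_on_iff_negligible)
qed

text \<open>Quadratically small increments give the indefinite integral \<open>G\<close> derivative
  zero at every time, so \<open>g\<close> has integral zero and its sign does the rest.\<close>

lemma negligible_nonzero_if_integral_quadratically_small:
  fixes g :: "real \<Rightarrow> real"
  assumes int: "g integrable_on {0..T}" and le: "\<And>t. t \<in> {0..T} \<Longrightarrow> g t \<le> 0"
    and "e > 0" and K: "\<And>a b. 0 \<le> a \<Longrightarrow> a < b \<Longrightarrow> b \<le> T \<Longrightarrow> b - a < e \<Longrightarrow>
      - K * (b - a)\<^sup>2 \<le> integral {a..b} g"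
  shows "negligible {t \<in> {0..T}. g t \<noteq> 0}"
proof (cases "T \<ge> 0")
  case False
  then show ?thesis by (simp add: )
next
  case True
  define G where "G t = integral {0..t} g" for t
  have inc: "G b - G a = integral {a..b} g" if "0 \<le> a" "a \<le> b" "b \<le> T" for a b
    unfolding G_def using that Henstock_Kurzweil_Integration.integral_combine[of 0 a b g] integrable_on_subinterval[OF int, of 0 b]
    by auto
  have sub: "g integrable_on {a..b}" if "0 \<le> a" "b \<le> T" for a b
    using that integrable_on_subinterval[OF int, of a b] by auto
  have neg: "integral {a..b} g \<le> 0" if "0 \<le> a" "b \<le> T" for a b
    using integral_le[OF sub[OF that], of "\<lambda>_. 0"] le that by auto
  have qb: "\<bar>G b - G a\<bar> \<le> K * (b - a)\<^sup>2" if "0 \<le> a" "a < b" "b \<le> T" "b - a < e" for a b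
    using K[OF that] neg[of a b] inc[of a b] that by auto
  have d0: "(G has_field_derivative 0) (at t within {0..T})" if t: "t \<in> {0..T}" for t
  proof -
    have "((\<lambda>y. (G y - G t) / (y - t)) \<longlongrightarrow> 0) (at t within {0..T})"
    proof (rule Lim_null_comparison)
      show "\<forall>\<^sub>F y in at t within {0..T}. norm ((G y - G t) / (y - t)) \<le> K * \<bar>y - t\<bar>"
        unfolding eventually_at
      proof (intro exI[of _ e] conjI ballI impI)
        fix y assume y: "y \<in> {0..T}" "y \<noteq> t \<and> dist y t < e"
        have "\<bar>G y - G t\<bar> \<le> K * (y - t)\<^sup>2"
          using qb[of t y] qb[of y t] y t
          by (cases "y < t") (auto simp: dist_real_def power2_commute abs_minus_commute)
        then show "norm ((G y - G t) / (y - t)) \<le> K * \<bar>y - t\<bar>"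
          using y(2) by (simp add: pos_divide_le_eq power2_eq_square mult.assoc)
      qed fact
      show "((\<lambda>y. K * \<bar>y - t\<bar>) \<longlongrightarrow> 0) (at t within {0..T})"
        by (auto intro!: tendsto_eq_intros)
    qed
    then show ?thesis by (simp add: has_field_derivative_iff)
  qed
  have "\<exists>c. \<forall>x\<in>{0..T}. G x = c"
    by (rule has_field_derivative_zero_constant) (auto intro: d0)
  then have "G T = G 0" using True by auto
  then have "integral {0..T} g = 0" using inc[of 0 T] True by auto
  then have h: "((\<lambda>t. - g t) has_integral 0) {0..T}"
    using has_integral_neg[OF integrable_integral[OF int]] by simp
  show ?thesis
    using negligible_nonzero_if_integral_0[OF h] le by simp
qed

section \<open>Running costs in the complex plane\<close>

text \<open>Applied to states and to adjoint vectors alike; in the latter case it yields lambda_x +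
  i lambda_y.\<close>

definition pos :: "real^5 \<Rightarrow> complex" where "pos s = Complex (s $ 1) (s $ 2)"

text \<open>The three running costs, rational functions of the position; at the origin both these and
  their counterparts in \<open>dynamics\<close> have the junk value 0.\<close>

definition kern1 :: "complex \<Rightarrow> real" where "kern1 z = (Re (inverse z))\<^sup>2"
definition kern2 :: "complex \<Rightarrow> real" where "kern2 z = (Im (inverse z))\<^sup>2"
definition kern3 :: "complex \<Rightarrow> real" where "kern3 z = - Re (inverse z) * Im (inverse z)"

text \<open>The state-dependent part of the Hamiltonian for the constant multipliers \<open>(- B, - A, 2 * C)\<close>, where
  \<open>A\<close>, \<open>B\<close>, \<open>C\<close> stand for the final values of \<open>z1\<close>, \<open>z2\<close>, \<open>z3\<close>.\<close>

definition lagr :: "real \<Rightarrow> real \<Rightarrow> real \<Rightarrow> complex \<Rightarrow> real" where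
  "lagr A B C z = 2 * C * kern3 z - B * kern1 z - A * kern2 z"

text \<open>The symmetric matrix of the quadratic form in w = 1/z. The sign of \<open>C\<close>
  comes from the conjugation hidden in the reciprocal.\<close>

definition qop :: "real \<Rightarrow> real \<Rightarrow> real \<Rightarrow> complex \<Rightarrow> complex" where
  "qop A B C w = Complex (- B * Re w - C * Im w) (- A * Im w - C * Re w)"

text \<open>Chain rule: the derivative of 1/z is multiplication by - 1/z^2, whose real adjoint is
  multiplication by the conjugate; the 2 comes from the quadratic form.\<close>

definition lagr_grad :: "real \<Rightarrow> real \<Rightarrow> real \<Rightarrow> complex \<Rightarrow> complex" where
  "lagr_grad A B C z = - 2 * (cnj (inverse z))\<^sup>2 * qop A B C (inverse z)"

lemma lagr_eq_inner: "lagr A B C z = qop A B C (inverse z) \<bullet> inverse z"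
  by (simp add: lagr_def kern1_def kern2_def kern3_def qop_def inner_complex_def
      power2_eq_square algebra_simps)

lemma inner_cnj_mult: "(cnj a * b) \<bullet> c = b \<bullet> (a * c)"
  by (simp add: inner_complex_def algebra_simps)

lemma lagr_grad_inner: "lagr_grad A B C z \<bullet> d = - 2 * (qop A B C (inverse z) \<bullet> ((inverse z)\<^sup>2 * d))"
proof -
  have "lagr_grad A B C z \<bullet> d = - 2 * ((cnj ((inverse z)\<^sup>2) * qop A B C (inverse z)) \<bullet> d)"
    by (simp add: lagr_grad_def inner_complex_def algebra_simps)
  then show ?thesis by (simp only: inner_cnj_mult)
qed

text \<open>Euler's identity for homogeneity of degree -2.\<close>

lemma lagr_grad_inner_self:
  assumes "z \<noteq> 0"
  shows "lagr_grad A B C z \<bullet> z = - 2 * lagr A B C z"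
proof -
  have "(inverse z)\<^sup>2 * z = inverse z"
    using assms by (simp add: power2_eq_square)
  then show ?thesis by (simp only: lagr_grad_inner lagr_eq_inner)
qed

lemma qop_inner_add: "qop A B C (w + u) \<bullet> (w + u) = qop A B C w \<bullet> w + 2 * (qop A B C w \<bullet> u) + qop A B C u \<bullet> u"
  by (simp add: qop_def inner_complex_def algebra_simps)

lemma norm_qop: "norm (qop A B C w) \<le> (\<bar>A\<bar> + \<bar>B\<bar> + 2 * \<bar>C\<bar>) * norm w"
proof -
  have "norm (qop A B C w) \<le> \<bar>- B * Re w - C * Im w\<bar> + \<bar>- A * Im w - C * Re w\<bar>"
    unfolding qop_def using cmod_le[of "Complex (- B * Re w - C * Im w) (- A * Im w - C * Re w)"] by simp
  also have "\<dots> \<le> (\<bar>B\<bar> * \<bar>Re w\<bar> + \<bar>C\<bar> * \<bar>Im w\<bar>) + (\<bar>A\<bar> * \<bar>Im w\<bar> + \<bar>C\<bar> * \<bar>Re w\<bar>)"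
    unfolding abs_mult[symmetric] by linarith
  also have "\<dots> \<le> (\<bar>B\<bar> * norm w + \<bar>C\<bar> * norm w) + (\<bar>A\<bar> * norm w + \<bar>C\<bar> * norm w)"
    by (intro add_mono mult_left_mono abs_Re_le_cmod abs_Im_le_cmod) auto
  finally show ?thesis by (simp add: algebra_simps)
qed

text \<open>The last two equations are exact remainders of first and second order for the
  reciprocal; they stand in for Taylor's theorem and lead to constants that depend on the position
  only through \<open>r\<close>.\<close>

lemma norm_inverse_add:
  fixes z d :: complex
  assumes "norm z \<ge> r" "r > 0" "norm d \<le> r / 2"
  shows "norm (inverse (z + d)) \<le> 2 / r" "norm (inverse z) \<le> 1 / r" "z \<noteq> 0" "z + d \<noteq> 0"
    "inverse (z + d) - inverse z = - (inverse z * inverse (z + d)) * d"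
    "inverse (z + d) - inverse z + (inverse z)\<^sup>2 * d = (inverse z)\<^sup>2 * inverse (z + d) * d\<^sup>2"
proof -
  have n: "norm (z + d) \<ge> r / 2"
    using norm_diff_ineq[of z d] assms by linarith
  show z: "z \<noteq> 0" "z + d \<noteq> 0" using n assms(1,2) by force+
  have "inverse (norm (z + d)) \<le> inverse (r / 2)"
    using n assms(2) by (intro le_imp_inverse_le) auto
  then show "norm (inverse (z + d)) \<le> 2 / r" by (simp add: norm_inverse)
  have "inverse (norm z) \<le> inverse r"
    using assms(1,2) by (intro le_imp_inverse_le) auto
  then show "norm (inverse z) \<le> 1 / r" by (simp add: norm_inverse divide_inverse)
  show e5: "inverse (z + d) - inverse z = - (inverse z * inverse (z + d)) * d"
    using z by (simp add: field_simps)
  show "inverse (z + d) - inverse z + (inverse z)\<^sup>2 * d = (inverse z)\<^sup>2 * inverse (z + d) * d\<^sup>2"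
  proof -
    have "inverse (z + d) - inverse z + (inverse z)\<^sup>2 * d
        = (inverse (z + d) - inverse z) + inverse z * inverse z * d"
      by (simp add: power2_eq_square)
    also have "\<dots> = - inverse z * d * (inverse (z + d) - inverse z)"
      by (subst e5) (simp add: algebra_simps)
    also have "\<dots> = (inverse z)\<^sup>2 * inverse (z + d) * d\<^sup>2"
      unfolding e5 by (simp add: power2_eq_square algebra_simps)
    finally show ?thesis .
  qed
qed

text \<open>The quadratic form expands exactly in the change \<open>u\<close> of the reciprocal, and
  \<open>u\<close> is its linear part plus the second-order remainder \<open>e\<close>. The 8 is 2 *
  1 * 2 from the \<open>e\<close> term plus 2 * 2 from the quadratic term.\<close>

lemma lagr_quadratic_bound:
  assumes "r > 0"
  obtains K where "K \<ge> 0" "\<And>z d. norm z \<ge> r \<Longrightarrow> norm d \<le> r / 2 \<Longrightarrow>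
    lagr A B C (z + d) \<le> lagr A B C z + lagr_grad A B C z \<bullet> d + K * (norm d)\<^sup>2"
proof
  let ?M = "\<bar>A\<bar> + \<bar>B\<bar> + 2 * \<bar>C\<bar>"
  show "?M * 8 / r ^ 4 \<ge> 0" using assms by simp
  fix z d :: complex assume zd: "norm z \<ge> r" "norm d \<le> r / 2"
  note ni = norm_inverse_add[OF zd(1) assms zd(2)]
  define w u where "w = inverse z" and "u = inverse (z + d) - inverse z"
  define e where "e = u + w\<^sup>2 * d"
  have u: "norm u \<le> 2 / r\<^sup>2 * norm d"
  proof -
    have "norm u = (norm w * norm (inverse (z + d))) * norm d"
      unfolding u_def w_def ni(5) by (simp add: norm_mult)
    also have "\<dots> \<le> (1 / r * (2 / r)) * norm d"
      using ni(1,2) assms by (intro mult_right_mono mult_mono) (auto simp: w_def)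
    finally show ?thesis by (simp add: power2_eq_square)
  qed
  have e: "norm e \<le> 2 / r ^ 3 * (norm d)\<^sup>2"
  proof -
    have "norm e = ((norm w)\<^sup>2 * norm (inverse (z + d))) * (norm d)\<^sup>2"
      unfolding e_def u_def w_def ni(6) by (simp add: norm_mult norm_power)
    also have "\<dots> \<le> ((1 / r)\<^sup>2 * (2 / r)) * (norm d)\<^sup>2"
      using ni(1,2) assms by (intro mult_right_mono mult_mono power_mono) (auto simp: w_def)
    finally show ?thesis by (simp add: power2_eq_square power3_eq_cube)
  qed
  have "lagr A B C (z + d) - lagr A B C z = 2 * (qop A B C w \<bullet> u) + qop A B C u \<bullet> u"
    using qop_inner_add[of A B C w u] by (simp add: lagr_eq_inner w_def u_def)
  also have "\<dots> = lagr_grad A B C z \<bullet> d + 2 * (qop A B C w \<bullet> e) + qop A B C u \<bullet> u"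
    by (simp add: lagr_grad_inner e_def inner_add_right flip: w_def)
  also have "\<dots> \<le> lagr_grad A B C z \<bullet> d + 2 * (?M * norm w * norm e) + ?M * norm u * norm u"
    by (intro add_mono order_refl mult_left_mono
        order_trans[OF norm_cauchy_schwarz] mult_right_mono norm_qop) auto
  also have "\<dots> \<le> lagr_grad A B C z \<bullet> d + 2 * (?M * (1 / r) * (2 / r ^ 3 * (norm d)\<^sup>2))
      + ?M * (2 / r\<^sup>2 * norm d) * (2 / r\<^sup>2 * norm d)"
    using ni(2) u e assms
    by (intro add_mono order_refl mult_left_mono mult_mono) (auto simp: w_def)
  also have "\<dots> = lagr_grad A B C z \<bullet> d + ?M * 8 / r ^ 4 * (norm d)\<^sup>2"
    using assms by (simp add: field_simps power2_eq_square power3_eq_cube power4_eq_xxxx)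
  finally show "lagr A B C (z + d) \<le> lagr A B C z + lagr_grad A B C z \<bullet> d + ?M * 8 / r ^ 4 * (norm d)\<^sup>2"
    by simp
qed

text \<open>Makes the final values change by O(b - a) in a needle variation, so that products of
  these changes are of second order. The 6 is 2 * 2 + 2 * 1 from the product rule.\<close>

lemma kern_lipschitz:
  assumes "r > 0"
  obtains K where "K \<ge> 0"
    "\<And>k z d. k \<in> {kern1, kern2, kern3} \<Longrightarrow> norm z \<ge> r \<Longrightarrow> norm d \<le> r / 2 \<Longrightarrow> \<bar>k (z + d) - k z\<bar> \<le> K * norm d"
proof
  show "6 / r ^ 3 \<ge> 0" using assms by simp
  fix k :: "complex \<Rightarrow> real" and z d :: complex
  assume k: "k \<in> {kern1, kern2, kern3}" and zd: "norm z \<ge> r" "norm d \<le> r / 2"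
  note ni = norm_inverse_add[OF zd(1) assms zd(2)]
  define w w' where "w = inverse z" and "w' = inverse (z + d)"
  have u: "norm (w' - w) \<le> 2 / r\<^sup>2 * norm d"
  proof -
    have "norm (w' - w) = (norm w * norm w') * norm d"
      unfolding w'_def w_def ni(5) by (simp add: norm_mult)
    also have "\<dots> \<le> (1 / r * (2 / r)) * norm d"
      using ni(1,2) assms by (intro mult_right_mono mult_mono) (auto simp: w_def w'_def)
    finally show ?thesis by (simp add: power2_eq_square)
  qed
  have prod: "\<bar>a' * b' - a * b\<bar> \<le> 6 / r ^ 3 * norm d"
    if "\<bar>a' - a\<bar> \<le> norm (w' - w)" "\<bar>b' - b\<bar> \<le> norm (w' - w)" "\<bar>a'\<bar> \<le> norm w'" "\<bar>b\<bar> \<le> norm w" for a a' b b' :: real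
  proof -
    have "a' * b' - a * b = a' * (b' - b) + (a' - a) * b" by (simp add: algebra_simps)
    then have "\<bar>a' * b' - a * b\<bar> \<le> \<bar>a'\<bar> * \<bar>b' - b\<bar> + \<bar>a' - a\<bar> * \<bar>b\<bar>"
      by (simp add: abs_triangle_ineq flip: abs_mult)
    also have "\<dots> \<le> (2 / r) * (2 / r\<^sup>2 * norm d) + (2 / r\<^sup>2 * norm d) * (1 / r)"
      using that u ni(1,2) assms unfolding w_def[symmetric] w'_def[symmetric]
      by (intro add_mono mult_mono) auto
    also have "\<dots> = 6 / r ^ 3 * norm d"
      using assms by (simp add: field_simps power2_eq_square power3_eq_cube)
    finally show ?thesis .
  qed
  note bnds = abs_Re_le_cmod[of w] abs_Im_le_cmod[of w] abs_Re_le_cmod[of w'] abs_Im_le_cmod[of w']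
    abs_Re_le_cmod[of "w' - w"] abs_Im_le_cmod[of "w' - w"]
  show "\<bar>k (z + d) - k z\<bar> \<le> 6 / r ^ 3 * norm d"
    using k prod[of "Re w'" "Re w" "Re w'" "Re w"] prod[of "Im w'" "Im w" "Im w'" "Im w"]
      prod[of "Re w'" "Re w" "Im w'" "Im w"] bnds
    by (auto simp: kern1_def kern2_def kern3_def power2_eq_square abs_minus_commute
        simp flip: w_def w'_def)
qed

lemma continuous_on_kern [continuous_intros]:
  assumes "continuous_on S f" "\<And>x. x \<in> S \<Longrightarrow> f x \<noteq> 0"
  shows "continuous_on S (\<lambda>x. kern1 (f x))" "continuous_on S (\<lambda>x. kern2 (f x))"
    "continuous_on S (\<lambda>x. kern3 (f x))"
  unfolding kern1_def kern2_def kern3_def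
  by (intro continuous_intros assms; use assms(2) in blast)+

lemma continuous_on_lagr_grad [continuous_intros]:
  assumes "continuous_on S f" "\<And>x. x \<in> S \<Longrightarrow> f x \<noteq> 0"
  shows "continuous_on S (\<lambda>x. lagr_grad A B C (f x))"
  unfolding lagr_grad_def qop_def complex_eq
  by (intro continuous_intros continuous_on_of_real assms; use assms(2) in blast)

lemma dynamics_components:
  "dynamics v s th $ 1 = Re (v * cis th)" "dynamics v s th $ 2 = Im (v * cis th)"
  "dynamics v s th $ 3 = kern1 (pos s)" "dynamics v s th $ 4 = kern2 (pos s)"
  "dynamics v s th $ 5 = kern3 (pos s)"
  by (simp_all add: dynamics_def Let_def vector_def pos_def kern1_def kern2_def kern3_def power_divide
    power2_eq_square)

section \<open>Feasible trajectories\<close>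

lemma forall_5: "(\<forall>i::5. P i) \<longleftrightarrow> P 1 \<and> P 2 \<and> P 3 \<and> P 4 \<and> P 5"
proof -
  have "i = 1 \<or> i = 2 \<or> i = 3 \<or> i = 4 \<or> i = 5" for i :: 5
  proof (induct i)
    case (of_int z)
    then have "z = 0 \<or> z = 1 \<or> z = 2 \<or> z = 3 \<or> z = 4" by fastforce
    then show ?case by auto
  qed
  then show ?thesis by metis
qed

lemma sum_5: "sum f (UNIV :: 5 set) = f 1 + f 2 + f 3 + f 4 + f 5"
proof -
  have U: "UNIV = {1, 2, 3, 4, 5::5}"
    using forall_5[of "\<lambda>i. i \<in> {1, 2, 3, 4, 5}"] by auto
  show ?thesis unfolding U by (simp add: ac_simps)
qed

lemma vector_5 [simp]:
  fixes a b c d e :: "'a::zero"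
  shows "(vector [a, b, c, d, e] :: 'a ^ 5) $ 1 = a"
    "(vector [a, b, c, d, e] :: 'a ^ 5) $ 2 = b"
    "(vector [a, b, c, d, e] :: 'a ^ 5) $ 3 = c"
    "(vector [a, b, c, d, e] :: 'a ^ 5) $ 4 = d"
    "(vector [a, b, c, d, e] :: 'a ^ 5) $ 5 = e"
  by (simp_all add: vector_def)

lemma has_integral_vec_iff:
  fixes f :: "'a::euclidean_space \<Rightarrow> real ^ 'n"
  shows "(f has_integral y) S \<longleftrightarrow> (\<forall>i. ((\<lambda>x. f x $ i) has_integral y $ i) S)"
  by (subst has_integral_componentwise_iff) (auto simp: Basis_vec_def inner_axis)

lemma borel_measurable_vec_iff:
  fixes f :: "'a \<Rightarrow> real ^ 'n"
  shows "f \<in> borel_measurable M \<longleftrightarrow> (\<forall>i. (\<lambda>x. f x $ i) \<in> borel_measurable M)"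
  by (subst borel_measurable_euclidean_space) (auto simp: Basis_vec_def inner_axis)

lemma bounded_linear_pos: "bounded_linear pos"
  unfolding linear_conv_bounded_linear[symmetric] pos_def
  by (rule linearI) (simp_all add: complex_eq_iff)

lemma pos_dynamics: "pos (dynamics v s th) = v * cis th"
  by (simp add: pos_def dynamics_components complex_eq_iff)

text \<open>The weak derivative equals \<open>dynamics\<close> off a null set, which integrals do
  not see; the state equation becomes a family of integral identities.\<close>

lemma feasibleD:
  assumes "feasible v tf x0 y0 s th"
  shows "th \<in> borel_measurable (lebesgue_on {0..tf})"
    and "integrable (lebesgue_on {0..tf}) (\<lambda>t. (th t)\<^sup>2)"
    and "\<And>t. t \<in> {0..tf} \<Longrightarrow> ((\<lambda>u. v * cis (th u)) has_integral pos (s t) - Complex x0 y0) {0..t}"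
    and "\<And>t. t \<in> {0..tf} \<Longrightarrow> ((\<lambda>u. kern1 (pos (s u))) has_integral s t $ 3) {0..t}"
    and "\<And>t. t \<in> {0..tf} \<Longrightarrow> ((\<lambda>u. kern2 (pos (s u))) has_integral s t $ 4) {0..t}"
    and "\<And>t. t \<in> {0..tf} \<Longrightarrow> ((\<lambda>u. kern3 (pos (s u))) has_integral s t $ 5) {0..t}"
proof -
  from assms obtain s' where L2: "L2_on 0 tf th"
    and s': "\<And>t. t \<in> {0..tf} \<Longrightarrow> (s' has_integral (s t - s 0)) {0..t}"
    and ae: "AE t in lebesgue_on {0..tf}. s' t = dynamics v (s t) (th t)"
    and s0: "s 0 = vector [x0, y0, 0, 0, 0]"
    unfolding feasible_def has_W12_deriv_def by blast
  show "th \<in> borel_measurable (lebesgue_on {0..tf})"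
    "integrable (lebesgue_on {0..tf}) (\<lambda>t. (th t)\<^sup>2)"
    using L2 by (simp_all add: L2_on_def)
  have neg: "negligible {t \<in> {0..tf}. s' t \<noteq> dynamics v (s t) (th t)}"
    using ae by (simp add: AE_lebesgue_on_iff_negligible)
  have dyn: "((\<lambda>u. dynamics v (s u) (th u)) has_integral (s t - s 0)) {0..t}" if "t \<in> {0..tf}" for t
    by (rule has_integral_spike[OF neg _ s'[OF that]]) (use that in auto)
  fix t assume t: "t \<in> {0..tf}"
  have "pos (s t - s 0) = pos (s t) - Complex x0 y0"
    by (simp add: s0 pos_def complex_eq_iff)
  with has_integral_linear[OF dyn[OF t] bounded_linear_pos]
  show "((\<lambda>u. v * cis (th u)) has_integral pos (s t) - Complex x0 y0) {0..t}"
    by (simp add: o_def pos_dynamics)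
  show "((\<lambda>u. kern1 (pos (s u))) has_integral s t $ 3) {0..t}"
    "((\<lambda>u. kern2 (pos (s u))) has_integral s t $ 4) {0..t}"
    "((\<lambda>u. kern3 (pos (s u))) has_integral s t $ 5) {0..t}"
    using dyn[OF t] by (simp_all add: has_integral_vec_iff forall_5 dynamics_components s0)
qed

lemma continuous_on_indefinite_integral:
  fixes f :: "real \<Rightarrow> 'a::banach"
  assumes "\<And>t. t \<in> {0..T} \<Longrightarrow> (f has_integral z t - c) {0..t}"
  shows "continuous_on {0..T} z"
proof (cases "0 \<le> T")
  case True
  then have "f integrable_on {0..T}"
    using assms[of T] by (auto simp: integrable_on_def)
  then have "continuous_on {0..T} (\<lambda>t. c + integral {0..t} f)"
    by (intro continuous_intros indefinite_integral_continuous_1)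
  moreover have "c + integral {0..t} f = z t" if "t \<in> {0..T}" for t
    using integral_unique[OF assms[OF that]] by simp
  ultimately show ?thesis
    by (rule continuous_on_eq)
qed simp

text \<open>Lets competitors be given as planar paths. Away from the origin the running costs are
  continuous along the path, hence bounded, and the planar speed is constant; this gives square
  integrability of the derivative.\<close>

lemma feasibleI:
  fixes z :: "real \<Rightarrow> complex"
  assumes tf: "0 \<le> tf" and meas: "th \<in> borel_measurable (lebesgue_on {0..tf})"
    and L2: "integrable (lebesgue_on {0..tf}) (\<lambda>t. (th t)\<^sup>2)"
    and z: "\<And>t. t \<in> {0..tf} \<Longrightarrow> ((\<lambda>u. v * cis (th u)) has_integral z t - Complex x0 y0) {0..t}"
    and nz: "\<And>t. t \<in> {0..tf} \<Longrightarrow> z t \<noteq> 0"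
  shows "feasible v tf x0 y0 (\<lambda>t. vector [Re (z t), Im (z t), integral {0..t} (\<lambda>u. kern1 (z u)),
      integral {0..t} (\<lambda>u. kern2 (z u)), integral {0..t} (\<lambda>u. kern3 (z u))]) th"
    (is "feasible v tf x0 y0 ?s th")
proof -
  define s' where "s' t = dynamics v (?s t) (th t)" for t
  have pos: "pos (?s t) = z t" for t by (simp add: pos_def)
  have comp: "s' t $ 1 = v * cos (th t)" "s' t $ 2 = v * sin (th t)" "s' t $ 3 = kern1 (z t)"
    "s' t $ 4 = kern2 (z t)" "s' t $ 5 = kern3 (z t)" for t
    by (simp_all add: s'_def dynamics_components pos)
  have cont: "continuous_on {0..tf} z"
    by (rule continuous_on_indefinite_integral[OF z])
  have kc: "continuous_on {0..tf} (\<lambda>t. kern1 (z t))" "continuous_on {0..tf} (\<lambda>t. kern2 (z t))"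
    "continuous_on {0..tf} (\<lambda>t. kern3 (z t))"
    by (intro continuous_intros cont nz; assumption)+
  have z0: "z 0 = Complex x0 y0"
    using z[of 0] tf by (simp add: has_integral_refl has_integral_iff)
  have s0: "?s 0 = vector [x0, y0, 0, 0, 0]"
    by (simp add: z0)
  have s'meas: "s' \<in> borel_measurable (lebesgue_on {0..tf})"
    unfolding borel_measurable_vec_iff forall_5 comp
    using meas kc by (auto intro!: continuous_imp_measurable_on_sets_lebesgue measurable_compose[OF meas])
  have "bounded ((\<lambda>t. (v\<^sup>2 + (kern1 (z t))\<^sup>2 + (kern2 (z t))\<^sup>2 + (kern3 (z t))\<^sup>2)) ` {0..tf})"
    by (intro compact_imp_bounded compact_continuous_image continuous_intros kc) auto
  then obtain M where M: "\<And>t. t \<in> {0..tf} \<Longrightarrow>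
      \<bar>v\<^sup>2 + (kern1 (z t))\<^sup>2 + (kern2 (z t))\<^sup>2 + (kern3 (z t))\<^sup>2\<bar> \<le> M"
    unfolding bounded_iff ball_simps real_norm_def by blast
  have sq: "(norm (s' t))\<^sup>2 = v\<^sup>2 + (kern1 (z t))\<^sup>2 + (kern2 (z t))\<^sup>2 + (kern3 (z t))\<^sup>2" for t
  proof -
    have "(norm (s' t))\<^sup>2 = (s' t $ 1)\<^sup>2 + (s' t $ 2)\<^sup>2 + (s' t $ 3)\<^sup>2 + (s' t $ 4)\<^sup>2 + (s' t $ 5)\<^sup>2"
      by (simp add: power2_norm_eq_inner inner_vec_def sum_5 flip: power2_eq_square)
    moreover have "(v * cos (th t))\<^sup>2 + (v * sin (th t))\<^sup>2 = v\<^sup>2"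
      by (simp add: power_mult_distrib flip: distrib_left)
    ultimately show ?thesis by (simp add: comp)
  qed
  have L2s: "L2_on 0 tf s'"
    unfolding L2_on_def
  proof
    show "integrable (lebesgue_on {0..tf}) (\<lambda>t. (norm (s' t))\<^sup>2)"
      by (rule measurable_bounded_by_integrable_imp_lebesgue_integrable[where g = "\<lambda>_. M"])
        (use s'meas M in \<open>auto simp: sq simp flip: sq\<close>)
  qed (rule s'meas)
  have "(s' has_integral (?s t - ?s 0)) {0..t}" if t: "t \<in> {0..tf}" for t
  proof -
    have "(\<lambda>u. k (z u)) integrable_on {0..t}" if "continuous_on {0..tf} (\<lambda>t. k (z t))"
      for k :: "complex \<Rightarrow> real"
      using integrable_continuous_real[OF continuous_on_subset[OF that]] t by auto
    with kc have "((\<lambda>u. kern1 (z u)) has_integral integral {0..t} (\<lambda>u. kern1 (z u))) {0..t}"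
      "((\<lambda>u. kern2 (z u)) has_integral integral {0..t} (\<lambda>u. kern2 (z u))) {0..t}"
      "((\<lambda>u. kern3 (z u)) has_integral integral {0..t} (\<lambda>u. kern3 (z u))) {0..t}"
      by blast+
    then show ?thesis
      unfolding has_integral_vec_iff forall_5 comp
      using has_integral_Re[OF z[OF t]] has_integral_Im[OF z[OF t]] by (simp add: z0)
  qed
  then have "has_W12_deriv 0 tf ?s s'"
    using L2s by (simp add: has_W12_deriv_def)
  moreover have "AE t in lebesgue_on {0..tf}. s' t = dynamics v (?s t) (th t)"
    by (simp add: s'_def)
  moreover have "L2_on 0 tf th"
    using meas L2 by (simp add: L2_on_def)
  ultimately show ?thesis
    using s0 unfolding feasible_def by blast
qed

section \<open>Derivatives along lines\<close>

lemma GDERIV_along_line: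
  assumes "GDERIV f x :> D"
  shows "((\<lambda>h. f (x + h *\<^sub>R e)) has_real_derivative (D \<bullet> e)) (at 0)"
proof -
  have "((\<lambda>h. x + h *\<^sub>R e) has_derivative (\<lambda>h. h *\<^sub>R e)) (at 0)"
    by (auto intro!: derivative_eq_intros)
  moreover have "(f has_derivative (\<lambda>h. h \<bullet> D)) (at (x + 0 *\<^sub>R e))"
    using assms by (simp add: gderiv_def)
  ultimately have "((\<lambda>h. f (x + h *\<^sub>R e)) has_derivative (\<lambda>h. (h *\<^sub>R e) \<bullet> D)) (at 0)"
    by (rule has_derivative_compose)
  then show ?thesis
    by (simp add: has_field_derivative_def inner_commute mult_commute_abs)
qed

text \<open>Justifies the formula for \<open>lagr_grad\<close>. Derivatives along lines suffice to
  identify the gradients in \<open>is_adjoint\<close>, whose existence is part of that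
  definition.\<close>

lemma lagr_directional_derivative:
  assumes "z \<noteq> 0"
  shows "((\<lambda>h. lagr A B C (z + h *\<^sub>R d)) has_real_derivative lagr_grad A B C z \<bullet> d) (at 0)"
proof -
  define w' where "w' = - ((inverse z)\<^sup>2 * d)"
  have "((\<lambda>h. z + h *\<^sub>R d) has_vector_derivative d) (at 0)"
    by (auto intro!: derivative_eq_intros)
  moreover have "(inverse has_field_derivative - ((inverse z)\<^sup>2)) (at (z + 0 *\<^sub>R d))"
    using assms by (auto intro!: derivative_eq_intros simp: power2_eq_square)
  ultimately have v: "((\<lambda>h. inverse (z + h *\<^sub>R d)) has_vector_derivative w') (at 0)"
    using field_vector_diff_chain_at[of "\<lambda>h. z + h *\<^sub>R d" d 0 inverse "- ((inverse z)\<^sup>2)"]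
    by (simp add: o_def w'_def mult.commute)
  have R: "((\<lambda>h. Re (inverse (z + h *\<^sub>R d))) has_real_derivative Re w') (at 0)"
    "((\<lambda>h. Im (inverse (z + h *\<^sub>R d))) has_real_derivative Im w') (at 0)"
    using bounded_linear.has_vector_derivative[OF bounded_linear_Re v]
      bounded_linear.has_vector_derivative[OF bounded_linear_Im v]
    by (simp_all add: has_real_derivative_iff_has_vector_derivative)
  have "lagr_grad A B C z \<bullet> d = 2 * (qop A B C (inverse z) \<bullet> w')"
    by (simp add: lagr_grad_inner w'_def)
  moreover have "((\<lambda>h. 2 * C * (- p h * q h) - B * (p h)\<^sup>2 - A * (q h)\<^sup>2) has_real_derivative
      2 * (qop A B C (Complex (p 0) (q 0)) \<bullet> Complex p' q')) (at 0)"
    if "(p has_real_derivative p') (at 0)" "(q has_real_derivative q') (at 0)" for p q p' q'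
    by (auto intro!: derivative_eq_intros that simp: qop_def inner_complex_def algebra_simps)
  from this[OF R] have "((\<lambda>h. lagr A B C (z + h *\<^sub>R d)) has_real_derivative
      2 * (qop A B C (inverse z) \<bullet> w')) (at 0)"
    unfolding lagr_def kern1_def kern2_def kern3_def by (simp only: scaleR_zero_left add_0_right complex_surj)
  ultimately show ?thesis by simp
qed

section \<open>Adjoint variables\<close>

lemma terminal_adjoint:
  assumes "GDERIV terminal_cost s :> p"
  shows "pos p = 0" "p $ 3 = - s $ 4" "p $ 4 = - s $ 3" "p $ 5 = 2 * s $ 5"
proof -
  have d: "((\<lambda>h. terminal_cost (s + h *\<^sub>R axis i 1)) has_real_derivative p $ i) (at 0)" for i
    using GDERIV_along_line[OF assms, of "axis i 1"] by (simp add: inner_axis)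
  have e: "((\<lambda>h. (s $ 5 + h * (if i = 5 then 1 else 0))\<^sup>2
      - (s $ 3 + h * (if i = 3 then 1 else 0)) * (s $ 4 + h * (if i = 4 then 1 else 0)))
      has_real_derivative (2 * s $ 5 * (if i = 5 then 1 else 0)
        - (if i = 3 then 1 else 0) * s $ 4 - (if i = 4 then 1 else 0) * s $ 3)) (at 0)" for i :: 5
    by (auto intro!: derivative_eq_intros)
  have "p $ i = 2 * s $ 5 * (if i = 5 then 1 else 0)
        - (if i = 3 then 1 else 0) * s $ 4 - (if i = 4 then 1 else 0) * s $ 3" for i
    by (rule DERIV_unique[OF d[of i]]) (use e[of i] in \<open>simp add: terminal_cost_def axis_def eq_commute\<close>)
  then show "pos p = 0" "p $ 3 = - s $ 4" "p $ 4 = - s $ 3" "p $ 5 = 2 * s $ 5"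
    by (simp_all add: pos_def complex_eq_iff)
qed

lemma hamiltonian_eq:
  "hamiltonian v s th p = pos p \<bullet> (v * cis th) + p $ 3 * kern1 (pos s) + p $ 4 * kern2 (pos s) + p $ 5 * kern3 (pos s)"
  by (simp add: hamiltonian_def inner_vec_def sum_5 dynamics_components inner_complex_def pos_def)

lemma pos_add_axis:
  "pos (s + h *\<^sub>R axis i 1) = pos s + h *\<^sub>R pos (axis i 1)"
  using bounded_linear_pos by (simp add: bounded_linear.linear linear_add linear_scale)

lemma pos_axis: "pos (axis 1 1) = 1" "pos (axis 2 1) = \<i>" "i \<notin> {1, 2} \<Longrightarrow> pos (axis i 1) = 0"
  by (auto simp: pos_def complex_eq_iff axis_def)

text \<open>Continuity at 0 is incompatible with a pole. The equation leaves \<open>f 0\<close>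
  free, so it covers the default value of the running costs at the origin.\<close>

lemma pole_imp_zero:
  fixes f :: "real \<Rightarrow> real"
  assumes f: "(f has_real_derivative D) (at 0)" and eq: "\<And>h. h \<noteq> 0 \<Longrightarrow> f h = c + k / h\<^sup>2"
  shows "k = 0"
proof -
  have "(f \<longlongrightarrow> f 0) (at 0)"
    using DERIV_isCont[OF f] by (simp add: isCont_def)
  then have "((\<lambda>h. (f h - c) * h\<^sup>2) \<longlongrightarrow> (f 0 - c) * 0\<^sup>2) (at 0)"
    by (intro tendsto_intros)
  moreover have "eventually (\<lambda>h. (f h - c) * h\<^sup>2 = k) (at 0)"
    using eq by (auto simp: eventually_at_filter)
  ultimately have "((\<lambda>h. k) \<longlongrightarrow> 0) (at (0::real))"
    by (simp add: Lim_transform_eventually)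
  then show ?thesis by (simp add: tendsto_const_iff)
qed

lemma lagr_axis:
  "lagr A B C (h *\<^sub>R 1) = - B / h\<^sup>2" "lagr A B C (h *\<^sub>R \<i>) = - A / h\<^sup>2"
proof -
  have "inverse (h *\<^sub>R 1) = complex_of_real (inverse h)" "inverse (h *\<^sub>R \<i>) = - (\<i> * complex_of_real (inverse h))"
    by (simp_all add: scaleR_conv_of_real inverse_mult_distrib)
  then show "lagr A B C (h *\<^sub>R 1) = - B / h\<^sup>2" "lagr A B C (h *\<^sub>R \<i>) = - A / h\<^sup>2"
    by (simp_all add: lagr_def kern1_def kern2_def kern3_def divide_inverse power_inverse
        del: inverse_complex.sel)
qed

text \<open>The adjoint equation presupposes a Hamiltonian differentiable in the state at every
  time. This excludes the origin once \<open>A\<close> or \<open>B\<close> is nonzero; comparing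
  partial derivatives then gives the planar adjoint equation.\<close>

lemma adjointD:
  assumes adj: "is_adjoint v tf s th p" and tf: "tf > 0"
  defines "A \<equiv> s tf $ 3" and "B \<equiv> s tf $ 4" and "C \<equiv> s tf $ 5"
  shows "pos (p tf) = 0"
    and "\<And>t. t \<in> {0..tf} \<Longrightarrow> A \<noteq> 0 \<or> B \<noteq> 0 \<Longrightarrow> pos (s t) \<noteq> 0"
    and "\<And>t. t \<in> {0..tf} \<Longrightarrow> pos (s t) \<noteq> 0 \<Longrightarrow>
      ((\<lambda>t. pos (p t)) has_vector_derivative - lagr_grad A B C (pos (s t))) (at t within {0..tf})"
proof -
  have trm: "GDERIV terminal_cost (s tf) :> p tf"
    using adj by (simp add: is_adjoint_def)
  show "pos (p tf) = 0" by (rule terminal_adjoint[OF trm])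
  obtain D where D: "\<And>t. t \<in> {0..tf} \<Longrightarrow> GDERIV (\<lambda>\<sigma>. hamiltonian v \<sigma> (th t) (p t)) (s t) :> D t"
    "\<And>t. t \<in> {0..tf} \<Longrightarrow> (p has_vector_derivative - D t) (at t within {0..tf})"
    using adj unfolding is_adjoint_def by metis
  have line: "((\<lambda>h. hamiltonian v (s t + h *\<^sub>R axis i 1) (th t) (p t)) has_real_derivative D t $ i) (at 0)"
    if "t \<in> {0..tf}" for t i
    using GDERIV_along_line[OF D(1)[OF that], of "axis i 1"] by (simp add: inner_axis)
  \<comment> \<open>The Hamiltonian does not depend on the last three state components, so their
    multipliers are constant.\<close>
  have const: "p t $ i = p tf $ i" if t: "t \<in> {0..tf}" and i: "i \<notin> {1, 2}" for t i
  proof (rule has_derivative_zero_unique[of "{0..tf}" "\<lambda>t. p t $ i"])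
    fix u assume u: "u \<in> {0..tf}"
    have "((\<lambda>h. hamiltonian v (s u + h *\<^sub>R axis i 1) (th u) (p u)) has_real_derivative 0) (at 0)"
      unfolding hamiltonian_eq pos_add_axis pos_axis(3)[OF i] by simp
    then have "D u $ i = 0" using line[OF u] DERIV_unique by blast
    moreover have "((\<lambda>t. p t $ i) has_vector_derivative (- D u) $ i) (at u within {0..tf})"
      by (rule bounded_linear.has_vector_derivative[OF bounded_linear_vec_nth D(2)[OF u]])
    ultimately show "((\<lambda>t. p t $ i) has_derivative (\<lambda>h. 0)) (at u within {0..tf})"
      by (simp add: has_vector_derivative_def)
  qed (use t tf in auto)
  have p345: "p t $ 3 = - B" "p t $ 4 = - A" "p t $ 5 = 2 * C" if "t \<in> {0..tf}" for t
    using const[OF that] terminal_adjoint(2-4)[OF trm] by (simp_all add: A_def B_def C_def)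
  have ham: "hamiltonian v \<sigma> (th t) (p t) = pos (p t) \<bullet> (v * cis (th t)) + lagr A B C (pos \<sigma>)"
    if "t \<in> {0..tf}" for t \<sigma>
    using p345[OF that] by (simp add: hamiltonian_eq lagr_def)
  show "pos (s t) \<noteq> 0" if t: "t \<in> {0..tf}" and ab: "A \<noteq> 0 \<or> B \<noteq> 0" for t
  proof
    assume 0: "pos (s t) = 0"
    note l = line[OF t, unfolded ham[OF t] pos_add_axis 0]
    \<comment> \<open>Approaching the origin along the real and the imaginary axis isolates the
      poles with coefficients \<open>- B\<close> and \<open>- A\<close>.\<close>
    have "- B = 0"
      by (rule pole_imp_zero[OF l[of 1, unfolded pos_axis], where c = "pos (p t) \<bullet> (v * cis (th t))"])
        (simp add: lagr_axis)
    moreover have "- A = 0"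
      by (rule pole_imp_zero[OF l[of 2, unfolded pos_axis], where c = "pos (p t) \<bullet> (v * cis (th t))"])
        (simp add: lagr_axis)
    ultimately show False using ab by simp
  qed
  fix t assume t: "t \<in> {0..tf}" and nz: "pos (s t) \<noteq> 0"
  have "D t $ i = lagr_grad A B C (pos (s t)) \<bullet> pos (axis i 1)" for i
    by (rule DERIV_unique[OF line[OF t]], unfold ham[OF t] pos_add_axis)
      (auto intro!: derivative_eq_intros lagr_directional_derivative[OF nz])
  then have "pos (- D t) = - lagr_grad A B C (pos (s t))"
    by (auto simp: pos_def[of "- D t"] pos_axis inner_complex_def complex_eq_iff)
  with bounded_linear.has_vector_derivative[OF bounded_linear_pos D(2)[OF t]]
  show "((\<lambda>t. pos (p t)) has_vector_derivative - lagr_grad A B C (pos (s t))) (at t within {0..tf})"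
    by simp
qed

lemma kern12_sum: "kern1 z + kern2 z = (norm (inverse z))\<^sup>2"
  by (simp only: kern1_def kern2_def cmod_power2)

text \<open>If both values vanished, then so would 1/|z|^2, with default 0 at the origin, almost
  everywhere; by continuity the path would rest at the origin, against its speed
  \<open>v\<close>.\<close>

lemma feasible_nondegenerate:
  assumes feas: "feasible v tf x0 y0 s th" and "v > 0" "tf > 0"
  shows "s tf $ 3 \<noteq> 0 \<or> s tf $ 4 \<noteq> 0"
proof (rule ccontr)
  assume "\<not> ?thesis"
  then have z: "s tf $ 3 = 0" "s tf $ 4 = 0" by auto
  note F = feasibleD[OF feas]
  define g where "g u = kern1 (pos (s u)) + kern2 (pos (s u))" for u
  have g: "(g has_integral 0) {0..tf}"
    using has_integral_add[OF F(4)[of tf] F(5)[of tf]] z assms(3) unfolding g_def by simp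
  have cont: "continuous_on {0..tf} (\<lambda>t. pos (s t))"
    by (rule continuous_on_indefinite_integral[OF F(3)])
  define U where "U = {t \<in> {0<..<tf}. pos (s t) \<noteq> 0}"
  have neg: "negligible {t \<in> {0..tf}. g t \<noteq> 0}"
    by (rule negligible_nonzero_if_integral_0[OF g]) (simp_all add: g_def kern12_sum)
  have "negligible U"
    by (rule negligible_subset[OF neg]) (auto simp: U_def g_def kern12_sum)
  moreover have "open U"
  proof -
    have "continuous_on {0<..<tf} (\<lambda>t. pos (s t))"
      by (rule continuous_on_subset[OF cont]) auto
    then have "open ({0<..<tf} \<inter> (\<lambda>t. pos (s t)) -` (- {0}))"
      by (rule continuous_open_preimage) auto
    moreover have "U = {0<..<tf} \<inter> (\<lambda>t. pos (s t)) -` (- {0})"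
      unfolding U_def by blast
    ultimately show ?thesis by simp
  qed
  ultimately have "U = {}" using open_not_negligible by blast
  then have 0: "pos (s t) = 0" if "t \<in> {0<..<tf}" for t using that by (auto simp: U_def)
  have pz: "pos (s t) = 0" if "t \<in> {0..tf}" for t
  proof (rule continuous_constant_on_closure[of "{0<..<tf}"])
    show "continuous_on (closure {0<..<tf}) (\<lambda>t. pos (s t))"
      using cont assms(3) by simp
  qed (use 0 that assms(3) in auto)
  then have "Complex x0 y0 = 0"
    using F(3)[of 0] assms(3) by (simp add: has_integral_iff)
  then have "((\<lambda>u. v * cis (th u)) has_integral 0) {0..t}" if "t \<in> {0..tf}" for t
    using F(3)[OF that] pz[OF that] by simp
  moreover have "norm (v * cis (th t)) = v" for t using assms(2) by (simp add: norm_mult)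
  ultimately show False
    using constant_norm_integral_nonzero[of tf "\<lambda>u. v * cis (th u)" v] assms by blast
qed

section \<open>Minimum principle\<close>

lemma borel_measurable_Arg [measurable]: "Arg \<in> borel_measurable borel"
proof -
  have "(\<lambda>z. if z = 0 then 0 else Im (Ln z)) \<in> borel_measurable borel"
    by measurable
  also have "(\<lambda>z. if z = 0 then 0 else Im (Ln z)) = Arg"
    by (auto simp: Arg_eq_Im_Ln Arg_def)
  finally show ?thesis .
qed

lemma norm_integral_le:
  fixes f :: "real \<Rightarrow> 'a::real_normed_vector"
  assumes "(f has_integral i) {a..b}" "a \<le> b" "\<And>x. x \<in> {a..b} \<Longrightarrow> norm (f x) \<le> K"
  shows "norm i \<le> K * (b - a)"
proof -
  have "0 \<le> K" using order_trans[OF norm_ge_zero assms(3)[of a]] assms(2) by simp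
  from has_integral_bound[OF this, of f i a b] assms show ?thesis by simp
qed

text \<open>The planar form of the problem, with the final values \<open>A\<close>,
  \<open>B\<close>, \<open>C\<close> as multipliers of the adjoint equation. Optimality is tested
  only against paths avoiding the origin; needle variations and one straight line are the
  competitors used.\<close>

locale extremal =
  fixes v tf A B C :: real and z l :: "real \<Rightarrow> complex" and th :: "real \<Rightarrow> real"
  assumes v: "v > 0" and tf: "tf > 0"
    and th_measurable: "th \<in> borel_measurable (lebesgue_on {0..tf})"
    and th_square_integrable: "integrable (lebesgue_on {0..tf}) (\<lambda>t. (th t)\<^sup>2)"
    and z_integral: "\<And>t. t \<in> {0..tf} \<Longrightarrow> ((\<lambda>u. v * cis (th u)) has_integral z t - z 0) {0..t}"
    and z_nonzero: "\<And>t. t \<in> {0..tf} \<Longrightarrow> z t \<noteq> 0"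
    and A: "((\<lambda>u. kern1 (z u)) has_integral A) {0..tf}"
    and B: "((\<lambda>u. kern2 (z u)) has_integral B) {0..tf}"
    and C: "((\<lambda>u. kern3 (z u)) has_integral C) {0..tf}"
    and l_derivative: "\<And>t. t \<in> {0..tf} \<Longrightarrow>
      (l has_vector_derivative - lagr_grad A B C (z t)) (at t within {0..tf})"
    and l_tf: "l tf = 0"
    and optimal: "\<And>th' z'. th' \<in> borel_measurable (lebesgue_on {0..tf}) \<Longrightarrow>
      integrable (lebesgue_on {0..tf}) (\<lambda>t. (th' t)\<^sup>2) \<Longrightarrow>
      (\<And>t. t \<in> {0..tf} \<Longrightarrow> ((\<lambda>u. v * cis (th' u)) has_integral z' t - z 0) {0..t}) \<Longrightarrow>
      (\<And>t. t \<in> {0..tf} \<Longrightarrow> z' t \<noteq> 0) \<Longrightarrow>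
      C\<^sup>2 - A * B \<le> (integral {0..tf} (\<lambda>u. kern3 (z' u)))\<^sup>2
        - integral {0..tf} (\<lambda>u. kern1 (z' u)) * integral {0..tf} (\<lambda>u. kern2 (z' u))"
begin

lemma continuous_z: "continuous_on {0..tf} z"
  by (rule continuous_on_indefinite_integral[OF z_integral])

lemma continuous_l: "continuous_on {0..tf} l"
  using l_derivative by (meson continuous_on_vector_derivative)

lemma continuous_grad: "continuous_on {0..tf} (\<lambda>t. lagr_grad A B C (z t))"
  by (intro continuous_on_lagr_grad continuous_z z_nonzero)

lemma z_bounded_away:
  obtains r where "r > 0" "\<And>t. t \<in> {0..tf} \<Longrightarrow> r \<le> norm (z t)"
proof -
  have "\<exists>x\<in>{0..tf}. \<forall>y\<in>{0..tf}. norm (z x) \<le> norm (z y)"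
    by (rule continuous_attains_inf) (use tf in \<open>auto intro!: continuous_intros continuous_z\<close>)
  then obtain x where "x \<in> {0..tf}" "\<forall>y\<in>{0..tf}. norm (z x) \<le> norm (z y)" by blast
  then show ?thesis using that[of "norm (z x)"] z_nonzero by simp
qed

lemma grad_bounded:
  obtains G where "G \<ge> 0" "\<And>t. t \<in> {0..tf} \<Longrightarrow> norm (lagr_grad A B C (z t)) \<le> G"
proof -
  have "bounded ((\<lambda>t. lagr_grad A B C (z t)) ` {0..tf})"
    by (intro compact_imp_bounded compact_continuous_image continuous_grad) simp
  then obtain G where "\<forall>t\<in>{0..tf}. norm (lagr_grad A B C (z t)) \<le> G"
    unfolding bounded_iff by blast
  then show ?thesis using that[of "max G 0"] by fastforce
qed

lemma l_integral:
  assumes "0 \<le> a" "a \<le> b" "b \<le> tf"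
  shows "((\<lambda>t. - lagr_grad A B C (z t)) has_integral l b - l a) {a..b}"
  using assms
  by (intro fundamental_theorem_of_calculus has_vector_derivative_within_subset[OF l_derivative]) auto

lemma l_lipschitz:
  assumes G: "\<And>t. t \<in> {0..tf} \<Longrightarrow> norm (lagr_grad A B C (z t)) \<le> G"
    and ab: "0 \<le> a" "a \<le> b" "b \<le> tf"
  shows "norm (l b - l a) \<le> G * (b - a)"
  by (rule norm_integral_le[OF l_integral[OF ab]]) (use G ab in auto)

text \<open>The change of velocity when the control is replaced by the minimizer of the Hamiltonian, which
  is opposite to the adjoint vector.\<close>

definition switch :: "real \<Rightarrow> complex" where
  "switch u = v * (cis (Arg (- l u)) - cis (th u))"

lemma norm_switch: "norm (switch u) \<le> 2 * v"
  using norm_triangle_ineq4[of "cis (Arg (- l u))" "cis (th u)"] v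
  by (simp add: switch_def norm_mult)

text \<open>Up to the factor \<open>- v\<close> this is the Cauchy-Schwarz defect of
  \<open>- l u\<close> and \<open>cis (th u)\<close>, so its vanishing is the pointwise minimum
  condition.\<close>

lemma inner_l_switch: "l u \<bullet> switch u = - v * (norm (l u) + l u \<bullet> cis (th u))"
proof (cases "l u = 0")
  case False
  then have cis: "cis (Arg (- l u)) = - sgn (l u)" using cis_Arg[of "- l u"] by (simp add: sgn_minus)
  have "l u \<bullet> sgn (l u) = norm (l u)"
    using False by (simp add: sgn_div_norm dot_square_norm power2_eq_square)
  then have "l u \<bullet> (- sgn (l u) - cis (th u)) = - (norm (l u) + l u \<bullet> cis (th u))"
    by (simp add: inner_diff_right)
  moreover have "l u \<bullet> (complex_of_real v * w) = v * (l u \<bullet> w)" for w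
    by (simp add: inner_complex_def algebra_simps)
  ultimately show ?thesis
    by (simp only: switch_def cis)
qed simp

lemma inner_l_switch_nonpos: "l u \<bullet> switch u \<le> 0"
proof -
  have "- (l u \<bullet> cis (th u)) \<le> norm (l u)"
    using norm_cauchy_schwarz[of "- l u" "cis (th u)"] by simp
  then show ?thesis unfolding inner_l_switch using v by (simp add: mult_nonneg_nonneg)
qed

lemma Arg_l_measurable: "(\<lambda>u. Arg (- l u)) \<in> borel_measurable (lebesgue_on {0..tf})"
  by (intro measurable_compose[OF _ borel_measurable_Arg] borel_measurable_uminus
      continuous_imp_measurable_on_sets_lebesgue continuous_l) simp

lemma cis_measurable: "cis \<in> borel_measurable borel"
  by (intro borel_measurable_continuous_onI continuous_intros)

lemma switch_integrable:
  assumes "0 \<le> a" "b \<le> tf"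
  shows "switch integrable_on {a..b}"
proof -
  have "switch integrable_on {0..tf}"
  proof (rule measurable_bounded_by_integrable_imp_integrable[where g = "\<lambda>_. 2 * v"])
    show "switch \<in> borel_measurable (lebesgue_on {0..tf})"
      unfolding switch_def
      by (intro borel_measurable_times borel_measurable_diff borel_measurable_const
          measurable_compose[OF _ cis_measurable] Arg_l_measurable th_measurable)
  qed (use norm_switch in auto)
  then show ?thesis by (rule integrable_on_subinterval) (use assms in auto)
qed

lemma inner_l_switch_integrable:
  assumes "0 \<le> a" "b \<le> tf"
  shows "(\<lambda>u. l u \<bullet> switch u) integrable_on {a..b}"
proof -
  have "bounded (l ` {0..tf})"
    by (intro compact_imp_bounded compact_continuous_image continuous_l) simp
  then obtain M where M: "\<forall>t\<in>{0..tf}. norm (l t) \<le> M"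
    unfolding bounded_iff by blast
  have "(\<lambda>u. l u \<bullet> switch u) integrable_on {0..tf}"
  proof (rule measurable_bounded_by_integrable_imp_integrable[where g = "\<lambda>_. M * (2 * v)"])
    show "(\<lambda>u. l u \<bullet> switch u) \<in> borel_measurable (lebesgue_on {0..tf})"
      unfolding switch_def
      by (intro borel_measurable_inner borel_measurable_times borel_measurable_diff borel_measurable_const
          measurable_compose[OF _ cis_measurable] Arg_l_measurable th_measurable
          continuous_imp_measurable_on_sets_lebesgue continuous_l) simp
    fix u assume "u \<in> {0..tf}"
    then have l: "norm (l u) \<le> M" using M by blast
    have "norm (l u \<bullet> switch u) \<le> norm (l u) * norm (switch u)"
      using Cauchy_Schwarz_ineq2 by simp
    also have "\<dots> \<le> M * (2 * v)"
      using l order_trans[OF norm_ge_zero l] by (intro mult_mono norm_switch) auto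
    finally show "norm (l u \<bullet> switch u) \<le> M * (2 * v)" .
  qed auto
  then show ?thesis by (rule integrable_on_subinterval) (use assms in auto)
qed

text \<open>
  The control is replaced by the minimizer of the Hamiltonian on an interval of length
  \<open>b - a\<close>. From time \<open>b\<close> on the displacement of the trajectory is constant, so the first-order
  change of the cost is the integral of \<open>l \<bullet> switch\<close> up to an error of order \<open>(b - a)\<^sup>2\<close>.
\<close>
lemma needle_variation:
  obtains e K where "e > 0"
    "\<And>a b. 0 \<le> a \<Longrightarrow> a < b \<Longrightarrow> b \<le> tf \<Longrightarrow> b - a < e \<Longrightarrow>
      - K * (b - a)\<^sup>2 \<le> integral {a..b} (\<lambda>u. l u \<bullet> switch u)"
proof -
  obtain r where r: "r > 0" "\<And>t. t \<in> {0..tf} \<Longrightarrow> r \<le> norm (z t)" by (rule z_bounded_away) blast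
  obtain G where G: "G \<ge> 0" "\<And>t. t \<in> {0..tf} \<Longrightarrow> norm (lagr_grad A B C (z t)) \<le> G"
    by (rule grad_bounded) blast
  obtain K1 where K1: "K1 \<ge> 0" "\<And>y d. norm y \<ge> r \<Longrightarrow> norm d \<le> r / 2 \<Longrightarrow>
    lagr A B C (y + d) \<le> lagr A B C y + lagr_grad A B C y \<bullet> d + K1 * (norm d)\<^sup>2"
    by (rule lagr_quadratic_bound[OF r(1)]) blast
  obtain K2 where K2: "K2 \<ge> 0"
    "\<And>k y d. k \<in> {kern1, kern2, kern3} \<Longrightarrow> norm y \<ge> r \<Longrightarrow> norm d \<le> r / 2 \<Longrightarrow> \<bar>k (y + d) - k y\<bar> \<le> K2 * norm d"
    by (rule kern_lipschitz[OF r(1)]) blast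
  \<comment> \<open>In order: products of the changes of the final values, the second-order term of
    \<open>lagr\<close>, and two errors of size \<open>2 * v * G\<close>, one from the drift during
    the needle and one from freezing \<open>l\<close> at time \<open>b\<close>.\<close>
  define K where "K = 2 * (K2 * (2 * v) * tf)\<^sup>2 + K1 * (2 * v)\<^sup>2 * tf + 4 * v * G"
  show ?thesis
  \<comment> \<open>The displacement is at most \<open>2 * v * (b - a)\<close>, so this threshold
    keeps it below \<open>r / 2\<close> and the varied path off the origin.\<close>
  proof (rule that[of "r / (4 * v)" K])
    show "r / (4 * v) > 0" using r v by simp
    fix a b assume ab: "0 \<le> a" "a < b" "b \<le> tf" and small: "b - a < r / (4 * v)"
    \<comment> \<open>Displacement of the varied path: zero up to \<open>a\<close>, where the
      interval is empty or a point, and constant from \<open>b\<close> on.\<close>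
    define \<xi> where "\<xi> t = integral {a..min t b} switch" for t
    define \<Delta> where "\<Delta> = integral {a..b} switch"
    define \<epsilon> where "\<epsilon> = b - a"
    have \<epsilon>: "\<epsilon> > 0" using ab by (simp add: \<epsilon>_def)
    have \<xi>_bound: "norm (\<xi> t) \<le> 2 * v * \<epsilon>" for t
    proof (cases "a \<le> min t b")
      case True
      then have "norm (\<xi> t) \<le> 2 * v * (min t b - a)"
        unfolding \<xi>_def using ab norm_switch
        by (intro norm_integral_le[OF integrable_integral[OF switch_integrable]]) auto
      also have "\<dots> \<le> 2 * v * \<epsilon>" using v by (auto simp: \<epsilon>_def)
      finally show ?thesis .
    next
      case False
      then show ?thesis using v \<epsilon> by (simp add: \<xi>_def)
    qed
    have \<xi>_half: "norm (\<xi> t) \<le> r / 2" for t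
      using \<xi>_bound[of t] small v by (simp add: \<epsilon>_def field_simps)
    have \<xi>_before: "\<xi> t = 0" if "t \<le> a" for t
      using that ab by (cases "t = a") (auto simp: \<xi>_def min_def)
    have \<xi>_after: "\<xi> t = \<Delta>" if "b \<le> t" for t
      using that by (simp add: \<xi>_def \<Delta>_def min_def)
    define th' where "th' t = (if t \<in> {a..b} then Arg (- l t) else th t)" for t
    define z' where "z' t = z t + \<xi> t" for t
    have z'_int: "((\<lambda>u. v * cis (th' u)) has_integral z' t - z 0) {0..t}" if t: "t \<in> {0..tf}" for t
    proof -
      have "(switch has_integral \<xi> t) {a..min t b}"
        unfolding \<xi>_def using ab t by (intro integrable_integral switch_integrable) auto
      moreover have "{a..min t b} = {a..b} \<inter> {0..t}" using ab by auto
      ultimately have "((\<lambda>u. if u \<in> {a..b} then switch u else 0) has_integral \<xi> t) {0..t}"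
        by (simp only: has_integral_restrict_Int)
      from has_integral_add[OF z_integral[OF t] this]
      have "((\<lambda>u. v * cis (th u) + (if u \<in> {a..b} then switch u else 0)) has_integral z' t - z 0) {0..t}"
        by (simp add: z'_def algebra_simps)
      moreover have "(\<lambda>u. v * cis (th u) + (if u \<in> {a..b} then switch u else 0)) = (\<lambda>u. v * cis (th' u))"
        by (auto simp: fun_eq_iff switch_def th'_def algebra_simps)
      ultimately show ?thesis by simp
    qed
    have z'_nz: "z' t \<noteq> 0" if "t \<in> {0..tf}" for t
      unfolding z'_def using norm_inverse_add(4)[OF r(2)[OF that] r(1) \<xi>_half] .
    have meas': "th' \<in> borel_measurable (lebesgue_on {0..tf})"
      unfolding th'_def
      by (intro measurable_If Arg_l_measurable th_measurable)
        (auto simp: space_restrict_space sets_restrict_space_iff Int_def[symmetric])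
    have L2': "integrable (lebesgue_on {0..tf}) (\<lambda>t. (th' t)\<^sup>2)"
    proof (rule Bochner_Integration.integrable_bound[where f = "\<lambda>t. (th t)\<^sup>2 + pi\<^sup>2"])
      show "integrable (lebesgue_on {0..tf}) (\<lambda>t. (th t)\<^sup>2 + pi\<^sup>2)"
        by (intro Bochner_Integration.integrable_add th_square_integrable) simp
      show "(\<lambda>t. (th' t)\<^sup>2) \<in> borel_measurable (lebesgue_on {0..tf})"
        by (intro borel_measurable_power meas')
      have "(Arg y)\<^sup>2 \<le> pi\<^sup>2" for y
        using Arg_bounded[of y] by (intro power2_le_iff_abs_le[THEN iffD2]) auto
      then show "AE t in lebesgue_on {0..tf}. norm ((th' t)\<^sup>2) \<le> norm ((th t)\<^sup>2 + pi\<^sup>2)"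
        by (intro AE_I2) (auto simp: th'_def add_increasing)
    qed
    have cont_z': "continuous_on {0..tf} z'"
      by (rule continuous_on_indefinite_integral[OF z'_int])
    have cont_\<xi>: "continuous_on {0..tf} \<xi>"
      using continuous_on_diff[OF cont_z' continuous_z] by (simp add: z'_def)
    define A' B' C' where "A' = integral {0..tf} (\<lambda>u. kern1 (z' u))"
      and "B' = integral {0..tf} (\<lambda>u. kern2 (z' u))" and "C' = integral {0..tf} (\<lambda>u. kern3 (z' u))"
    have A': "((\<lambda>u. kern1 (z' u)) has_integral A') {0..tf}"
      and B': "((\<lambda>u. kern2 (z' u)) has_integral B') {0..tf}"
      and C': "((\<lambda>u. kern3 (z' u)) has_integral C') {0..tf}"
      unfolding A'_def B'_def C'_def using cont_z' z'_nz
      by (auto intro!: integrable_integral integrable_continuous_real continuous_on_kern)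
    have opt: "C\<^sup>2 - A * B \<le> C'\<^sup>2 - A' * B'"
      unfolding A'_def B'_def C'_def by (rule optimal[OF meas' L2' z'_int z'_nz])
    have kd: "\<bar>I' - I\<bar> \<le> K2 * (2 * v) * tf * \<epsilon>"
      if "k \<in> {kern1, kern2, kern3}" "((\<lambda>u. k (z' u)) has_integral I') {0..tf}"
        "((\<lambda>u. k (z u)) has_integral I) {0..tf}" for k I I'
    proof -
      have "norm (I' - I) \<le> K2 * (2 * v * \<epsilon>) * (tf - 0)"
      proof (rule norm_integral_le[OF has_integral_diff[OF that(2,3)]])
        fix u assume u: "u \<in> {0..tf}"
        have "\<bar>k (z' u) - k (z u)\<bar> \<le> K2 * norm (\<xi> u)"
          unfolding z'_def by (rule K2(2)[OF that(1) r(2)[OF u] \<xi>_half])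
        also have "\<dots> \<le> K2 * (2 * v * \<epsilon>)"
          using \<xi>_bound K2(1) by (intro mult_left_mono)
        finally show "norm (k (z' u) - k (z u)) \<le> K2 * (2 * v * \<epsilon>)" by simp
      qed (use tf in simp)
      then show ?thesis by (simp add: algebra_simps)
    qed
    let ?Q = "K2 * (2 * v) * tf * \<epsilon>"
    have dA: "\<bar>A' - A\<bar> \<le> ?Q" and dB: "\<bar>B' - B\<bar> \<le> ?Q" and dC: "\<bar>C' - C\<bar> \<le> ?Q"
      by (rule kd[OF _ A' A] kd[OF _ B' B] kd[OF _ C' C], simp)+
    \<comment> \<open>Exact expansion of the quadratic cost; the linear part has the multipliers as
      coefficients and is therefore the integral of the change of \<open>lagr\<close>.\<close>
    have lin: "0 \<le> (2 * C * (C' - C) - B * (A' - A) - A * (B' - B)) + 2 * ?Q\<^sup>2"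
    proof -
      have "(C' - C)\<^sup>2 \<le> ?Q\<^sup>2"
        using dC by (metis abs_ge_zero abs_of_nonneg order_trans power2_le_iff_abs_le)
      moreover have "- ((A' - A) * (B' - B)) \<le> ?Q * ?Q"
      proof -
        have "- ((A' - A) * (B' - B)) \<le> \<bar>A' - A\<bar> * \<bar>B' - B\<bar>"
          by (metis abs_ge_minus_self abs_mult)
        also have "\<dots> \<le> ?Q * ?Q" using dA dB order_trans[OF abs_ge_zero dA] by (intro mult_mono) simp_all
        finally show ?thesis .
      qed
      moreover have "C'\<^sup>2 - A' * B' - (C\<^sup>2 - A * B) =
          (2 * C * (C' - C) - B * (A' - A) - A * (B' - B)) + (C' - C)\<^sup>2 - (A' - A) * (B' - B)"
        by (simp add: power2_eq_square algebra_simps)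
      ultimately show ?thesis using opt by (simp add: power2_eq_square)
    qed
    have first: "((\<lambda>u. lagr A B C (z' u) - lagr A B C (z u)) has_integral
        (2 * C * (C' - C) - B * (A' - A) - A * (B' - B))) {0..tf}"
    proof -
      have "((\<lambda>u. (2 * C * kern3 (z' u) - B * kern1 (z' u) - A * kern2 (z' u))
          - (2 * C * kern3 (z u) - B * kern1 (z u) - A * kern2 (z u))) has_integral
          (2 * C * C' - B * A' - A * B') - (2 * C * C - B * A - A * B)) {0..tf}"
        by (intro has_integral_diff has_integral_mult_right A B C A' B' C')
      then show ?thesis by (simp add: lagr_def algebra_simps)
    qed
    let ?g = "\<lambda>u. lagr_grad A B C (z u) \<bullet> \<xi> u"
    have gint: "?g integrable_on {s..t}" if "0 \<le> s" "t \<le> tf" for s t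
      by (intro integrable_continuous_real continuous_on_inner continuous_on_subset[OF continuous_grad]
          continuous_on_subset[OF cont_\<xi>]) (use that in auto)
    have "2 * C * (C' - C) - B * (A' - A) - A * (B' - B)
        \<le> integral {0..tf} ?g + K1 * (2 * v * \<epsilon>)\<^sup>2 * tf"
    proof (rule has_integral_le[OF first])
      have "((\<lambda>u. K1 * (2 * v * \<epsilon>)\<^sup>2) has_integral K1 * (2 * v * \<epsilon>)\<^sup>2 * tf) {0..tf}"
        using has_integral_const_real[of "K1 * (2 * v * \<epsilon>)\<^sup>2" 0 tf] tf by (simp add: mult.commute)
      then show "((\<lambda>u. ?g u + K1 * (2 * v * \<epsilon>)\<^sup>2) has_integral integral {0..tf} ?g + K1 * (2 * v * \<epsilon>)\<^sup>2 * tf) {0..tf}"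
        by (intro has_integral_add integrable_integral gint) auto
      fix u assume u: "u \<in> {0..tf}"
      have "K1 * (norm (\<xi> u))\<^sup>2 \<le> K1 * (2 * v * \<epsilon>)\<^sup>2"
        using \<xi>_bound K1(1) by (intro mult_left_mono power_mono) auto
      then show "lagr A B C (z' u) - lagr A B C (z u) \<le> ?g u + K1 * (2 * v * \<epsilon>)\<^sup>2"
        using K1(2)[OF r(2)[OF u] \<xi>_half[of u]] unfolding z'_def by linarith
    qed
    moreover have "integral {0..tf} ?g \<le> G * (2 * v * \<epsilon>) * \<epsilon> + l b \<bullet> \<Delta>"
    proof -
      have "integral {0..tf} ?g = integral {0..a} ?g + integral {a..b} ?g + integral {b..tf} ?g"
        using Henstock_Kurzweil_Integration.integral_combine[of 0 a b ?g]
          Henstock_Kurzweil_Integration.integral_combine[of 0 b tf ?g] gint ab tf by auto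
      moreover have "integral {0..a} ?g = 0"
        by (rule integral_unique) (rule has_integral_is_0, use \<xi>_before in auto)
      moreover have "integral {a..b} ?g \<le> G * (2 * v * \<epsilon>) * \<epsilon>"
      proof -
        have "norm (integral {a..b} ?g) \<le> G * (2 * v * \<epsilon>) * (b - a)"
        proof (rule norm_integral_le[OF integrable_integral[OF gint]])
          fix u assume u: "u \<in> {a..b}"
          have "norm (?g u) \<le> norm (lagr_grad A B C (z u)) * norm (\<xi> u)"
            using Cauchy_Schwarz_ineq2 by auto
          also have "\<dots> \<le> G * (2 * v * \<epsilon>)"
            using u ab G by (intro mult_mono \<xi>_bound G(2)) auto
          finally show "norm (?g u) \<le> G * (2 * v * \<epsilon>)" .
        qed (use ab in auto)
        then show ?thesis by (simp add: \<epsilon>_def)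
      qed
      \<comment> \<open>The displacement is constant here, and the gradient integrates to
        \<open>l b\<close> by the adjoint equation and \<open>l tf = 0\<close>.\<close>
      moreover have "integral {b..tf} ?g = l b \<bullet> \<Delta>"
      proof (rule integral_unique)
        have "((\<lambda>u. - lagr_grad A B C (z u) \<bullet> \<Delta>) has_integral (l tf - l b) \<bullet> \<Delta>) {b..tf}"
          using has_integral_linear[OF l_integral bounded_linear_inner_left, of b tf \<Delta>] ab
          by (simp add: o_def)
        then have "((\<lambda>u. lagr_grad A B C (z u) \<bullet> \<Delta>) has_integral l b \<bullet> \<Delta>) {b..tf}"
          using has_integral_neg[of "\<lambda>u. - lagr_grad A B C (z u) \<bullet> \<Delta>" "(l tf - l b) \<bullet> \<Delta>"]
          by (simp add: l_tf)
        then show "(?g has_integral l b \<bullet> \<Delta>) {b..tf}"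
          by (rule has_integral_eq[rotated]) (simp add: \<xi>_after)
      qed
      ultimately show ?thesis by simp
    qed
    moreover have "l b \<bullet> \<Delta> \<le> integral {a..b} (\<lambda>u. l u \<bullet> switch u) + G * \<epsilon> * (2 * v) * \<epsilon>"
    proof (rule has_integral_le)
      have "(switch has_integral \<Delta>) {a..b}"
        unfolding \<Delta>_def using ab by (intro integrable_integral switch_integrable) auto
      then show "((\<lambda>u. l b \<bullet> switch u) has_integral l b \<bullet> \<Delta>) {a..b}"
        using has_integral_linear[OF _ bounded_linear_inner_right, of switch \<Delta> "{a..b}" "l b"]
        by (simp add: o_def)
      have "((\<lambda>u. G * \<epsilon> * (2 * v)) has_integral G * \<epsilon> * (2 * v) * \<epsilon>) {a..b}"
        using has_integral_const_real[of "G * \<epsilon> * (2 * v)" a b] ab by (simp add: \<epsilon>_def mult.commute)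
      then show "((\<lambda>u. l u \<bullet> switch u + G * \<epsilon> * (2 * v)) has_integral
          integral {a..b} (\<lambda>u. l u \<bullet> switch u) + G * \<epsilon> * (2 * v) * \<epsilon>) {a..b}"
        using ab by (intro has_integral_add integrable_integral inner_l_switch_integrable) auto
      fix u assume u: "u \<in> {a..b}"
      have "(l b - l u) \<bullet> switch u \<le> norm (l b - l u) * norm (switch u)"
        by (rule norm_cauchy_schwarz)
      also have "\<dots> \<le> (G * \<epsilon>) * (2 * v)"
      proof (intro mult_mono norm_switch)
        have "norm (l b - l u) \<le> G * (b - u)" using G(2) u ab by (intro l_lipschitz) auto
        also have "\<dots> \<le> G * \<epsilon>" using u G(1) by (intro mult_left_mono) (auto simp: \<epsilon>_def)
        finally show "norm (l b - l u) \<le> G * \<epsilon>" .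
      qed (use G(1) \<epsilon> in auto)
      finally show "l b \<bullet> switch u \<le> l u \<bullet> switch u + G * \<epsilon> * (2 * v)"
        by (simp add: inner_diff_left)
    qed
    ultimately have "0 \<le> integral {a..b} (\<lambda>u. l u \<bullet> switch u) + G * \<epsilon> * (2 * v) * \<epsilon>
        + G * (2 * v * \<epsilon>) * \<epsilon> + K1 * (2 * v * \<epsilon>)\<^sup>2 * tf + 2 * ?Q\<^sup>2"
      using lin by linarith
    also have "\<dots> = integral {a..b} (\<lambda>u. l u \<bullet> switch u) + K * \<epsilon>\<^sup>2"
      by (simp add: K_def power2_eq_square algebra_simps)
    finally show "- K * (b - a)\<^sup>2 \<le> integral {a..b} (\<lambda>u. l u \<bullet> switch u)"
      by (simp add: \<epsilon>_def)
  qed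
qed

theorem minimum_principle:
  obtains N where "negligible N" "\<And>t. t \<in> {0..tf} - N \<Longrightarrow> l t \<bullet> cis (th t) = - norm (l t)"
proof -
  obtain e K where e: "e > 0" and K:
    "\<And>a b. 0 \<le> a \<Longrightarrow> a < b \<Longrightarrow> b \<le> tf \<Longrightarrow> b - a < e \<Longrightarrow>
      - K * (b - a)\<^sup>2 \<le> integral {a..b} (\<lambda>u. l u \<bullet> switch u)"
    by (rule needle_variation) blast
  have "negligible {t \<in> {0..tf}. l t \<bullet> switch t \<noteq> 0}"
    by (rule negligible_nonzero_if_integral_quadratically_small[OF _ _ e K])
      (auto intro: inner_l_switch_integrable inner_l_switch_nonpos)
  moreover have "l t \<bullet> cis (th t) = - norm (l t)" if "l t \<bullet> switch t = 0" for t
    using that v unfolding inner_l_switch by simp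
  ultimately show ?thesis using that by blast
qed

end

section \<open>Zeros of the adjoint vector\<close>

lemma Re_inverse_eq: "Re (inverse z) = Re z * (norm (inverse z))\<^sup>2"
  and Im_inverse_eq: "Im (inverse z) = - Im z * (norm (inverse z))\<^sup>2"
  by (simp_all add: norm_inverse power_inverse cmod_power2 divide_inverse)

text \<open>The negative of the right-hand side of the explicit equation for lambda_x, with (x^2 +
  y^2)^3 in the denominator written as a sixth power of |1/z|.\<close>

lemma Re_lagr_grad:
  "Re (lagr_grad A B C z) = - 2 * (norm (inverse z)) ^ 6 *
     (- B * (Re z) ^ 3 + 3 * C * (Re z)\<^sup>2 * Im z + (B - 2 * A) * Re z * (Im z)\<^sup>2 - C * (Im z) ^ 3)"
proof -
  define n where "n = (norm (inverse z))\<^sup>2"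
  have n6: "(norm (inverse z)) ^ 6 = n ^ 3" by (simp add: n_def flip: power_mult)
  have "Re (lagr_grad A B C z) = - 2 * (qop A B C (inverse z) \<bullet> (inverse z)\<^sup>2)"
    using lagr_grad_inner[of A B C z 1] by (simp add: inner_complex_def)
  also have "\<dots> = - 2 * ((- B * Re (inverse z) - C * Im (inverse z)) * ((Re (inverse z))\<^sup>2 - (Im (inverse z))\<^sup>2)
      + (- A * Im (inverse z) - C * Re (inverse z)) * (2 * Re (inverse z) * Im (inverse z)))"
    by (simp add: qop_def inner_complex_def power2_eq_square del: inverse_complex.sel)
  finally show ?thesis
    unfolding Re_inverse_eq Im_inverse_eq n6 n_def[symmetric]
    by (simp add: power2_eq_square power3_eq_cube algebra_simps)
qed

text \<open>Strict Cauchy--Schwarz inequality: along a line not through the origin, the real and the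
  imaginary part of \<open>inverse z\<close> are linearly independent functions.\<close>
lemma tangential_line_cost_negative:
  fixes z0 :: complex and \<mu> T :: real
  assumes "z0 \<noteq> 0" "\<mu> > 0" "T > 0"
  defines "z t \<equiv> z0 * (1 + \<i> * of_real (\<mu> * t))"
  shows "(integral {0..T} (\<lambda>t. kern3 (z t)))\<^sup>2
    - integral {0..T} (\<lambda>t. kern1 (z t)) * integral {0..T} (\<lambda>t. kern2 (z t)) < 0"
proof (rule ccontr)
  assume neg: "\<not> ?thesis"
  \<comment> \<open>The line leaves \<open>z0\<close> at right angles to the radius, so it misses
    the origin.\<close>
  have "1 + \<i> * of_real (\<mu> * t) \<noteq> 0" for t by (simp add: complex_eq_iff)
  then have nz: "z t \<noteq> 0" for t using assms(1) unfolding z_def by (simp only: mult_eq_0_iff) simp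
  define u w where "u t = Re (inverse (z t))" and "w t = Im (inverse (z t))" for t
  have ci: "continuous_on {0..T} (\<lambda>t. inverse (z t))"
    unfolding z_def by (intro continuous_intros) (use nz in \<open>simp add: z_def\<close>)
  have cu: "continuous_on {0..T} u" and cw: "continuous_on {0..T} w"
    unfolding u_def w_def by (intro continuous_intros ci)+
  define a b c where "a = integral {0..T} (\<lambda>t. (u t)\<^sup>2)" and "b = integral {0..T} (\<lambda>t. (w t)\<^sup>2)"
    and "c = integral {0..T} (\<lambda>t. - u t * w t)"
  have cab: "a * b \<le> c\<^sup>2"
    using neg by (simp add: a_def b_def c_def u_def w_def kern1_def kern2_def kern3_def)
  have ha: "((\<lambda>t. (u t)\<^sup>2) has_integral a) {0..T}" and hb: "((\<lambda>t. (w t)\<^sup>2) has_integral b) {0..T}"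
    and hc: "((\<lambda>t. - u t * w t) has_integral c) {0..T}"
    unfolding a_def b_def c_def
    by (intro integrable_integral integrable_continuous_real continuous_intros cu cw)+
  have a0: "a \<ge> 0" and b0: "b \<ge> 0"
    unfolding a_def b_def by (intro integral_nonneg has_integral_integrable[OF ha] has_integral_integrable[OF hb]; simp)+
  have zero: "p * u t + q * w t = 0"
    if "p\<^sup>2 * a - 2 * p * q * c + q\<^sup>2 * b \<le> 0" "t \<in> {0..T}" for p q t
  proof -
    have h: "((\<lambda>t. (p * u t + q * w t)\<^sup>2) has_integral (p\<^sup>2 * a - 2 * p * q * c + q\<^sup>2 * b)) {0..T}"
    proof -
      have "((\<lambda>t. p\<^sup>2 * (u t)\<^sup>2 - 2 * p * q * (- u t * w t) + q\<^sup>2 * (w t)\<^sup>2) has_integral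
          (p\<^sup>2 * a - 2 * p * q * c + q\<^sup>2 * b)) {0..T}"
        by (intro has_integral_add has_integral_diff has_integral_mult_right ha hb hc)
      then show ?thesis by (simp add: power2_eq_square algebra_simps)
    qed
    have "integral {0..T} (\<lambda>t. (p * u t + q * w t)\<^sup>2) = 0"
      using has_integral_nonneg[OF h] integral_unique[OF h] that(1) by simp
    moreover have "continuous_on {0..T} (\<lambda>t. (p * u t + q * w t)\<^sup>2)"
      by (intro continuous_intros cu cw)
    ultimately have "(p * u t + q * w t)\<^sup>2 = 0"
      using integral_eq_0_iff[of 0 T "\<lambda>t. (p * u t + q * w t)\<^sup>2"] assms(3) that(2) by simp
    then show ?thesis by simp
  qed
  \<comment> \<open>The form in \<open>zero\<close> is the integral of
    \<open>(p * u t + q * w t)\<^sup>2\<close>. At (b, c) and (c, a) it is a nonnegative number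
    times \<open>a * b - c\<^sup>2\<close>, so under the contrary assumption both combinations
    vanish.\<close>
  have "b\<^sup>2 * a - 2 * b * c * c + c\<^sup>2 * b = b * (a * b - c\<^sup>2)"
    "c\<^sup>2 * a - 2 * c * a * c + a\<^sup>2 * b = a * (a * b - c\<^sup>2)"
    by (simp_all add: power2_eq_square algebra_simps)
  with cab a0 b0 have le: "b\<^sup>2 * a - 2 * b * c * c + c\<^sup>2 * b \<le> 0" "c\<^sup>2 * a - 2 * c * a * c + a\<^sup>2 * b \<le> 0"
    by (simp_all add: mult_nonneg_nonpos)
  have "norm (inverse (z t)) \<noteq> 0" for t using nz by simp
  then have lin: "b * Re (z t) = c * Im (z t)" "c * Re (z t) = a * Im (z t)" if "t \<in> {0..T}" for t
    using zero[OF le(1) that] zero[OF le(2) that] unfolding u_def w_def Re_inverse_eq Im_inverse_eq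
    by (simp_all add: mult.assoc[symmetric] flip: left_diff_distrib)
  have R: "Re (z t) = Re z0 - \<mu> * t * Im z0" "Im (z t) = Im z0 + \<mu> * t * Re z0" for t
    by (simp_all add: z_def algebra_simps)
  \<comment> \<open>Comparing the relations at times \<open>0\<close> and \<open>T\<close> yields
    them for \<open>z0\<close> and for \<open>\<i> * z0\<close>. These span the plane, which forces
    \<open>a = 0\<close> and \<open>b = 0\<close>.\<close>
  have l0: "b * Re z0 = c * Im z0" "c * Re z0 = a * Im z0"
    using lin[of 0] assms(3) by (simp_all add: R)
  have "\<mu> * T * (- b * Im z0) = \<mu> * T * (c * Re z0)" "\<mu> * T * (- c * Im z0) = \<mu> * T * (a * Re z0)"
    using lin[of T] l0 assms(3) by (simp_all add: R algebra_simps)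
  moreover have "\<mu> * T \<noteq> 0" using assms(2,3) by simp
  ultimately have l1: "- b * Im z0 = c * Re z0" "- c * Im z0 = a * Re z0"
    by (metis mult_left_cancel)+
  have sq: "(Re z0)\<^sup>2 + (Im z0)\<^sup>2 \<noteq> 0" using assms(1) by (simp add: complex_eq_iff sum_power2_eq_zero_iff)
  have "b * ((Re z0)\<^sup>2 + (Im z0)\<^sup>2) = Re z0 * (b * Re z0) - Im z0 * (- b * Im z0)"
    by (simp add: power2_eq_square algebra_simps)
  also have "\<dots> = 0" unfolding l0(1) l1(1) by simp
  finally have "b = 0" using sq by (metis mult_eq_0_iff)
  have "a * ((Re z0)\<^sup>2 + (Im z0)\<^sup>2) = Re z0 * (a * Re z0) + Im z0 * (a * Im z0)"
    by (simp add: power2_eq_square algebra_simps)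
  also have "\<dots> = 0" unfolding l0(2)[symmetric] l1(2)[symmetric] by simp
  finally have "a = 0" using sq by (metis mult_eq_0_iff)
  have "u 0 = 0" "w 0 = 0"
    using zero[of 1 0 0] zero[of 0 1 0] assms(3) \<open>a = 0\<close> \<open>b = 0\<close> by simp_all
  then have "inverse (z 0) = 0" by (simp add: u_def w_def complex_eq_iff)
  then show False using nz by simp
qed

lemma eq_arctan_tan_plus_pi_multiple:
  assumes "cos x \<noteq> 0"
  shows "\<exists>k::int. x = arctan (tan x) + of_int k * pi"
proof -
  let ?y = "arctan (tan x)"
  have c: "cos ?y \<noteq> 0" by simp
  have "sin ?y / cos ?y = sin x / cos x" using tan_arctan[of "tan x"] by (simp add: tan_def)
  then have "sin (x - ?y) = 0" using c assms by (simp add: sin_diff field_simps)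
  then obtain i :: int where "x - ?y = of_int i * pi" using sin_zero_iff_int2 by blast
  then show ?thesis by (intro exI[of _ i]) simp
qed

context extremal
begin

section \<open>Definiteness of the quadratic form and direction of the control\<close>

lemma C_squared_less: "C\<^sup>2 < A * B"
proof -
  \<comment> \<open>Chosen so that the line is traversed with speed \<open>v\<close>.\<close>
  define \<mu> where "\<mu> = v / norm (z 0)"
  define z' where "z' t = z 0 * (1 + \<i> * of_real (\<mu> * t))" for t :: real
  have z0: "z 0 \<noteq> 0" using z_nonzero[of 0] tf by simp
  then have \<mu>: "\<mu> > 0" using v by (simp add: \<mu>_def)
  have "C\<^sup>2 - A * B \<le> (integral {0..tf} (\<lambda>u. kern3 (z' u)))\<^sup>2
        - integral {0..tf} (\<lambda>u. kern1 (z' u)) * integral {0..tf} (\<lambda>u. kern2 (z' u))"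
  proof (rule optimal[where th' = "\<lambda>_. Arg (\<i> * z 0)"])
    fix t assume t: "t \<in> {0..tf}"
    have "1 + \<i> * of_real (\<mu> * t) \<noteq> 0" by (simp add: complex_eq_iff)
    then show "z' t \<noteq> 0" using z0 unfolding z'_def by (simp only: mult_eq_0_iff) simp
    have "cis (Arg (\<i> * z 0)) = \<i> * z 0 / norm (z 0)"
      using z0 cis_Arg[of "\<i> * z 0"] by (simp add: sgn_eq norm_mult)
    then have "t *\<^sub>R (v * cis (Arg (\<i> * z 0))) = z' t - z 0"
      by (simp add: z'_def \<mu>_def scaleR_conv_of_real algebra_simps)
    then show "((\<lambda>u. v * cis (Arg (\<i> * z 0))) has_integral z' t - z 0) {0..t}"
      using has_integral_const_real[of "v * cis (Arg (\<i> * z 0))" 0 t] t by simp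
  qed auto
  also have "\<dots> < 0"
    unfolding z'_def by (rule tangential_line_cost_negative[OF z0 \<mu> tf])
  finally show ?thesis by simp
qed

lemma A_pos: "A > 0" and B_pos: "B > 0"
proof -
  have "A \<ge> 0" "B \<ge> 0"
    using has_integral_nonneg[OF A] has_integral_nonneg[OF B] by (auto simp: kern1_def kern2_def)
  moreover have "0 < A * B" using C_squared_less by (rule le_less_trans[OF zero_le_power2])
  ultimately show "A > 0" "B > 0" by (auto simp: zero_less_mult_iff)
qed

lemma lagr_negative:
  assumes "y \<noteq> 0"
  shows "lagr A B C y < 0"
proof -
  define u w where "u = Re (inverse y)" and "w = Im (inverse y)"
  have uw: "u \<noteq> 0 \<or> w \<noteq> 0"
    using assms complex_eq_iff[of "inverse y" 0] by (simp add: u_def w_def del: inverse_complex.sel)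
  \<comment> \<open>Completing the square; \<open>A * B - C\<^sup>2\<close> is the determinant of
    the form.\<close>
  have "A * lagr A B C y = - ((C * u + A * w)\<^sup>2 + (A * B - C\<^sup>2) * u\<^sup>2)"
    by (simp add: lagr_def kern1_def kern2_def kern3_def power2_eq_square algebra_simps
        del: inverse_complex.sel flip: u_def w_def)
  also have "\<dots> < 0"
  proof (cases "u = 0")
    case True
    then show ?thesis using uw A_pos by simp
  next
    case False
    then have "(A * B - C\<^sup>2) * u\<^sup>2 > 0" using C_squared_less by simp
    then show ?thesis using zero_le_power2[of "C * u + A * w"] by linarith
  qed
  finally show ?thesis using A_pos by (simp add: mult_less_0_iff)
qed

lemma grad_nonzero:
  assumes "t \<in> {0..tf}"
  shows "lagr_grad A B C (z t) \<noteq> 0"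
proof
  assume "lagr_grad A B C (z t) = 0"
  then have "lagr A B C (z t) = 0"
    using lagr_grad_inner_self[OF z_nonzero[OF assms], of A B C] by simp
  then show False using lagr_negative[OF z_nonzero[OF assms]] by simp
qed

lemma countable_zeros: "countable {t \<in> {0..tf}. l t = 0}"
proof -
  let ?Z = "{t \<in> {0..tf}. l t = 0}"
  have "\<not> t islimpt ?Z" if t: "t \<in> {0..tf}" "l t = 0" for t
  proof
    assume "t islimpt ?Z"
    from vector_derivative_zero_at_limit_of_zeros[OF l_derivative[OF t(1)] this _ t(2)]
    have "- lagr_grad A B C (z t) = 0" by blast
    then show False using grad_nonzero[OF t(1)] by simp
  qed
  then have "{t \<in> ?Z. \<not> t islimpt ?Z} = ?Z" by blast
  then show ?thesis using countable_isolated_points[of ?Z] by simp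
qed

lemma control_direction:
  obtains N where "negligible N" "\<And>t. t \<in> {0..tf} - N \<Longrightarrow> cis (th t) = - sgn (l t) \<and> l t \<noteq> 0"
proof -
  obtain N where N: "negligible N" "\<And>t. t \<in> {0..tf} - N \<Longrightarrow> l t \<bullet> cis (th t) = - norm (l t)"
    by (rule minimum_principle) blast
  show ?thesis
  proof
    show "negligible (N \<union> {t \<in> {0..tf}. l t = 0})"
      by (rule negligible_Un[OF N(1) countable_imp_negligible[OF countable_zeros]])
    fix t assume t: "t \<in> {0..tf} - (N \<union> {t \<in> {0..tf}. l t = 0})"
    then have nz: "l t \<noteq> 0" by blast
    have "l t \<bullet> cis (th t) = - norm (l t)" using N(2)[of t] t by blast
    then have s: "sgn (l t) \<bullet> cis (th t) = - 1" using nz by (simp add: sgn_div_norm)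
    \<comment> \<open>Equality in Cauchy-Schwarz: unit vectors with inner product -1 are
      opposite.\<close>
    have "(norm (cis (th t) + sgn (l t)))\<^sup>2 = (norm (cis (th t)))\<^sup>2 + (norm (sgn (l t)))\<^sup>2 + 2 * (sgn (l t) \<bullet> cis (th t))"
      unfolding power2_norm_eq_inner inner_add_left inner_add_right
      using inner_commute[of "cis (th t)" "sgn (l t)"] by linarith
    also have "\<dots> = 0" using s nz by (simp add: norm_sgn)
    finally show "cis (th t) = - sgn (l t) \<and> l t \<noteq> 0" using nz by (simp add: eq_neg_iff_add_eq_0)
  qed
qed

section \<open>The closed system for position and adjoint vector\<close>

text \<open>Eliminates the control: the direction is known off a null set, which includes the zeros
  of \<open>l\<close>, where \<open>sgn\<close> takes the default 0.\<close>

lemma z_integral_sgn: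
  assumes "0 \<le> a" "a \<le> b" "b \<le> tf"
  shows "((\<lambda>u. - (v * sgn (l u))) has_integral z b - z a) {a..b}"
proof -
  obtain N where N: "negligible N" "\<And>t. t \<in> {0..tf} - N \<Longrightarrow> cis (th t) = - sgn (l t) \<and> l t \<noteq> 0"
    by (rule control_direction) blast
  have h: "((\<lambda>u. - (v * sgn (l u))) has_integral z t - z 0) {0..t}" if "t \<in> {0..tf}" for t
    by (rule has_integral_spike[OF N(1) _ z_integral[OF that]]) (use N(2) that in auto)
  have "(\<lambda>u. - (v * sgn (l u))) integrable_on {a..b}"
    by (rule integrable_on_subinterval[OF has_integral_integrable[OF h[of b]]]) (use assms in auto)
  moreover have "integral {a..b} (\<lambda>u. - (v * sgn (l u))) = z b - z a"
    using Henstock_Kurzweil_Integration.integral_combine[OF assms(1,2) has_integral_integrable[OF h[of b]]]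
      integral_unique[OF h[of a]] integral_unique[OF h[of b]] assms by (simp add: algebra_simps)
  ultimately show ?thesis by (metis integrable_integral)
qed

text \<open>\<open>sgn (l u)\<close> is continuous near nonzero values of \<open>l\<close>, so the
  derivative exists at every such time and not just almost everywhere; limit points can then be
  treated individually.\<close>

lemma z_derivative:
  assumes t: "t \<in> {0..tf}" and nz: "l t \<noteq> 0"
  shows "(z has_vector_derivative - (v * sgn (l t))) (at t within {0..tf})"
proof -
  let ?f = "\<lambda>u. - (v * sgn (l u))"
  have "(l \<longlongrightarrow> l t) (at t within {0..tf})"
    using continuous_l t by (simp add: continuous_on_def)
  then have "continuous (at t within ({0..tf} - {})) ?f"
    unfolding continuous_within using nz by (auto intro!: tendsto_intros)
  from integral_has_vector_derivative_continuous_at[OF has_integral_integrable[OF z_integral_sgn] _ _ this]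
  have "((\<lambda>u. integral {0..u} ?f) has_vector_derivative ?f t) (at t within {0..tf})"
    using t tf by simp
  from has_vector_derivative_add[OF has_vector_derivative_const this]
  have "((\<lambda>u. z 0 + integral {0..u} ?f) has_vector_derivative ?f t) (at t within {0..tf})"
    by (simp only: add_0_left)
  then show ?thesis
    by (rule has_vector_derivative_transform_within[OF _ zero_less_one t])
      (use integral_unique[OF z_integral_sgn] in auto)
qed

lemma Re_l_lipschitz_on:
  assumes ab: "0 \<le> a" "a \<le> b" "b \<le> tf" and "t \<in> {a..b}" "t1 \<in> {a..b}"
    and M: "\<And>u. u \<in> {a..b} \<Longrightarrow> \<bar>Re (lagr_grad A B C (z u))\<bar> \<le> M"
  shows "\<bar>Re (l t) - Re (l t1)\<bar> \<le> M * \<bar>t - t1\<bar>"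
proof -
  have *: "\<bar>Re (l y) - Re (l x)\<bar> \<le> M * (y - x)" if "x \<in> {a..b}" "y \<in> {a..b}" "x \<le> y" for x y
  proof -
    have "norm (Re (l y - l x)) \<le> M * (y - x)"
      by (rule norm_integral_le[OF has_integral_Re[OF l_integral]]) (use that ab M in auto)
    then show ?thesis by simp
  qed
  show ?thesis using *[of t t1] *[of t1 t] assms(4,5) by (cases "t \<le> t1") (auto simp: abs_minus_commute)
qed

text \<open>\<open>M\<close> bounds the horizontal part of \<open>sgn (l u)\<close>; the default
  \<open>sgn 0 = 0\<close> preserves the bound at zeros of \<open>l\<close>.\<close>

lemma Re_z_lipschitz_on:
  assumes ab: "0 \<le> a" "a \<le> b" "b \<le> tf" and "t \<in> {a..b}" "t1 \<in> {a..b}"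
    and M: "\<And>u. u \<in> {a..b} \<Longrightarrow> \<bar>Re (l u)\<bar> \<le> M * norm (l u)" and "M \<ge> 0"
  shows "\<bar>Re (z t) - Re (z t1)\<bar> \<le> v * M * \<bar>t - t1\<bar>"
proof -
  have *: "\<bar>Re (z y) - Re (z x)\<bar> \<le> v * M * (y - x)" if xy: "x \<in> {a..b}" "y \<in> {a..b}" "x \<le> y" for x y
  proof -
    have "norm (Re (z y - z x)) \<le> v * M * (y - x)"
    proof (rule norm_integral_le[OF has_integral_Re[OF z_integral_sgn]])
      fix u assume "u \<in> {x..y}"
      then have "\<bar>Re (l u)\<bar> \<le> M * norm (l u)" using M xy by auto
      then have "\<bar>Re (sgn (l u))\<bar> \<le> M"
        using \<open>M \<ge> 0\<close> by (cases "l u = 0") (simp_all add: sgn_div_norm abs_mult field_simps)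
      then have "v * \<bar>Re (sgn (l u))\<bar> \<le> v * M" using v by (intro mult_left_mono) auto
      moreover have "Re (- (v * sgn (l u))) = - v * Re (sgn (l u))" by simp
      then have "norm (Re (- (v * sgn (l u)))) = v * \<bar>Re (sgn (l u))\<bar>"
        using v by (simp only: real_norm_def abs_mult abs_minus_cancel abs_of_pos)
      ultimately show "norm (Re (- (v * sgn (l u)))) \<le> v * M" by (simp only:)
    qed (use xy ab in auto)
    then show ?thesis by simp
  qed
  show ?thesis using *[of t t1] *[of t1 t] assms(4,5) by (cases "t \<le> t1") (auto simp: abs_minus_commute)
qed

text \<open>At a zero of \<open>l\<close> the derivative is nonzero and half of its norm survives
  the remainder; elsewhere continuity keeps \<open>l\<close> away from zero. One bound thus serves
  both cases of \<open>axis_local\<close>.\<close>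

lemma l_linear_growth:
  assumes t1: "t1 \<in> {0..tf}"
  obtains c d where "c > 0" "d > 0"
    "\<And>t. t \<in> {0..tf} \<Longrightarrow> \<bar>t - t1\<bar> < d \<Longrightarrow> c * \<bar>t - t1\<bar> \<le> norm (l t)"
proof (cases "l t1 = 0")
  case True
  let ?D = "- lagr_grad A B C (z t1)"
  have D: "norm ?D > 0" using grad_nonzero[OF t1] by simp
  have "\<forall>e>0. \<exists>d>0. \<forall>t\<in>{0..tf}. norm (t - t1) < d \<longrightarrow> norm (l t - l t1 - (t - t1) *\<^sub>R ?D) \<le> e * norm (t - t1)"
    using l_derivative[OF t1] unfolding has_vector_derivative_def has_derivative_within_alt by blast
  then obtain d where d: "d > 0"
    "\<And>t. t \<in> {0..tf} \<Longrightarrow> \<bar>t - t1\<bar> < d \<Longrightarrow> norm (l t - (t - t1) *\<^sub>R ?D) \<le> norm ?D / 2 * \<bar>t - t1\<bar>"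
    using D half_gt_zero[OF D] True by (metis diff_zero real_norm_def)
  show ?thesis
  proof (rule that[of "norm ?D / 2" d])
    fix t assume t: "t \<in> {0..tf}" "\<bar>t - t1\<bar> < d"
    have "\<bar>t - t1\<bar> * norm ?D \<le> norm (l t) + norm (l t - (t - t1) *\<^sub>R ?D)"
      using norm_triangle_sub[of "(t - t1) *\<^sub>R ?D" "l t"] by (simp add: norm_minus_commute)
    then show "norm ?D / 2 * \<bar>t - t1\<bar> \<le> norm (l t)" using d(2)[OF t] by (simp add: algebra_simps)
  qed (use D d in auto)
next
  case False
  then obtain d where d: "d > 0" "\<And>t. t \<in> {0..tf} \<Longrightarrow> dist t t1 < d \<Longrightarrow> dist (l t) (l t1) < norm (l t1) / 2"
    using continuous_l t1 unfolding continuous_on_iff by (metis half_gt_zero zero_less_norm_iff)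
  show ?thesis
  \<comment> \<open>Division by \<open>tf\<close> turns the constant lower bound into a linear one,
    as \<open>\<bar>t - t1\<bar> \<le> tf\<close>.\<close>
  proof (rule that[of "norm (l t1) / (2 * tf)" d])
    fix t assume t: "t \<in> {0..tf}" "\<bar>t - t1\<bar> < d"
    have "norm (l t1) \<le> norm (l t) + dist (l t) (l t1)"
      using norm_triangle_sub[of "l t1" "l t"] by (simp add: dist_norm norm_minus_commute)
    then have "norm (l t1) / 2 \<le> norm (l t)"
      using d(2)[of t] t by (simp add: dist_real_def)
    moreover have "norm (l t1) / (2 * tf) * \<bar>t - t1\<bar> \<le> norm (l t1) / (2 * tf) * tf"
      using t t1 tf by (intro mult_left_mono) auto
    ultimately show "norm (l t1) / (2 * tf) * \<bar>t - t1\<bar> \<le> norm (l t)" using tf by simp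
  qed (use False d tf in auto)
qed

text \<open>Local uniqueness of the extremal on the imaginary axis; the right-hand side of the state
  equation is not Lipschitz at zeros of \<open>l\<close>, which is compensated by the linear growth of \<open>l\<close> there.\<close>
lemma axis_local:
  assumes C0: "C = 0" and t1: "t1 \<in> {0..tf}" and Rez: "Re (z t1) = 0" and Rel: "Re (l t1) = 0"
  shows "\<exists>e>0. \<forall>t\<in>{0..tf}. dist t t1 < e \<longrightarrow> Re (z t) = 0 \<and> Re (l t) = 0"
proof -
  obtain c d where c: "c > 0" and d: "d > 0" and growth:
    "\<And>t. t \<in> {0..tf} \<Longrightarrow> \<bar>t - t1\<bar> < d \<Longrightarrow> c * \<bar>t - t1\<bar> \<le> norm (l t)"
    by (rule l_linear_growth[OF t1]) blast
  \<comment> \<open>For \<open>C = 0\<close> the cubic form has the factor \<open>Re z\<close>; this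
    is the cofactor, so the horizontal gradient is linearly bounded by \<open>Re z\<close>.\<close>
  let ?q = "\<lambda>t. - 2 * (norm (inverse (z t))) ^ 6 * (- B * (Re (z t))\<^sup>2 + (B - 2 * A) * (Im (z t))\<^sup>2)"
  have "continuous_on {0..tf} ?q"
    by (intro continuous_intros continuous_z) (use z_nonzero in auto)
  then have "bounded (?q ` {0..tf})"
    by (intro compact_imp_bounded compact_continuous_image) auto
  then obtain k where k: "\<forall>t\<in>{0..tf}. \<bar>?q t\<bar> \<le> k"
    unfolding bounded_iff ball_simps real_norm_def by blast
  have k0: "k \<ge> 0" using order_trans[OF abs_ge_zero k[rule_format, OF t1]] .
  have grad: "\<bar>Re (lagr_grad A B C (z t))\<bar> \<le> k * \<bar>Re (z t)\<bar>" if "t \<in> {0..tf}" for t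
  proof -
    have "Re (lagr_grad A B C (z t)) = ?q t * Re (z t)"
      by (simp add: Re_lagr_grad C0 power2_eq_square power3_eq_cube algebra_simps)
    then show ?thesis using k that by (simp only: abs_mult) (intro mult_right_mono, auto)
  qed
  \<comment> \<open>Makes the contraction factor \<open>v * (k / c) * e\<close> at most 1/2; the
    \<open>+ 1\<close> covers \<open>k = 0\<close>.\<close>
  define e where "e = min (d / 2) (c / (2 * v * (k + 1)))"
  have e: "e > 0" "e < d" using c d v k0 by (auto simp: e_def)
  have contr: "v * (k / c) * e \<le> 1 / 2"
  proof -
    have "v * (k / c) * e \<le> v * (k / c) * (c / (2 * v * (k + 1)))"
      using v k0 c by (intro mult_left_mono) (auto simp: e_def)
    also have "\<dots> = k / (2 * (k + 1))"
    proof -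
      have "v * (k / c) * (c / (2 * v * y)) = k / (2 * y)" if "y > 0" for y
        using v c that by (simp add: field_simps)
      then show ?thesis using k0 by simp
    qed
    also have "\<dots> \<le> 1 / 2" using k0 by (simp add: field_simps)
    finally show ?thesis .
  qed
  define a b where "a = max 0 (t1 - e)" and "b = min tf (t1 + e)"
  have ab: "0 \<le> a" "a \<le> b" "b \<le> tf" "t1 \<in> {a..b}" using t1 e by (auto simp: a_def b_def)
  have near: "\<bar>u - t1\<bar> \<le> e" if "u \<in> {a..b}" for u using that by (auto simp: a_def b_def)
  have "\<exists>x\<in>{a..b}. \<forall>y\<in>{a..b}. \<bar>Re (z y)\<bar> \<le> \<bar>Re (z x)\<bar>"
    by (rule continuous_attains_sup)
      (use ab in \<open>auto intro!: continuous_intros continuous_on_subset[OF continuous_z]\<close>)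
  then obtain m where m: "m \<in> {a..b}" "\<And>y. y \<in> {a..b} \<Longrightarrow> \<bar>Re (z y)\<bar> \<le> \<bar>Re (z m)\<bar>" by blast
  let ?M = "\<bar>Re (z m)\<bar>"
  have l_small: "\<bar>Re (l u)\<bar> \<le> k * ?M * \<bar>u - t1\<bar>" if u: "u \<in> {a..b}" for u
  proof -
    have "\<bar>Re (l u) - Re (l t1)\<bar> \<le> k * ?M * \<bar>u - t1\<bar>"
    proof (rule Re_l_lipschitz_on[OF ab(1-3) u ab(4)])
      fix w assume w: "w \<in> {a..b}"
      show "\<bar>Re (lagr_grad A B C (z w))\<bar> \<le> k * ?M"
        using grad[of w] mult_left_mono[OF m(2)[OF w] k0] w ab by auto
    qed
    then show ?thesis by (simp add: Rel)
  qed
  have ratio: "\<bar>Re (l u)\<bar> \<le> k * ?M / c * norm (l u)" if u: "u \<in> {a..b}" for u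
  proof -
    have "k * ?M * \<bar>u - t1\<bar> = k * ?M / c * (c * \<bar>u - t1\<bar>)" using c by simp
    also have "\<dots> \<le> k * ?M / c * norm (l u)"
      using growth[of u] near[OF u] e u ab k0 c by (intro mult_left_mono) auto
    finally show ?thesis using l_small[OF u] by linarith
  qed
  \<comment> \<open>The factor \<open>\<bar>u - t1\<bar>\<close> in the bound for
    \<open>Re (l u)\<close> has cancelled against the growth of \<open>l\<close>. The maximum
    \<open>?M\<close> is now at most half of itself.\<close>
  have "\<bar>Re (z m) - Re (z t1)\<bar> \<le> v * (k * ?M / c) * \<bar>m - t1\<bar>"
    by (rule Re_z_lipschitz_on[OF ab(1-3) m(1) ab(4) ratio]) (use k0 c in auto)
  also have "\<dots> \<le> v * (k * ?M / c) * e"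
    using near[OF m(1)] v k0 c by (intro mult_left_mono) auto
  also have "\<dots> = v * (k / c) * e * ?M" by simp
  also have "\<dots> \<le> 1 / 2 * ?M" using contr by (intro mult_right_mono) auto
  finally have M0: "?M = 0" by (simp add: Rez)
  show ?thesis
  proof (intro exI[of _ e] conjI ballI impI)
    fix t assume "t \<in> {0..tf}" "dist t t1 < e"
    then have t: "t \<in> {a..b}" by (auto simp: a_def b_def dist_real_def)
    show "Re (z t) = 0" using m(2)[OF t] M0 by simp
    show "Re (l t) = 0" using l_small[OF t] M0 by simp
  qed (rule e)
qed

text \<open>The times at which both real parts vanish form a set closed by continuity and open by
  \<open>axis_local\<close>; connectedness spreads it over the interval.\<close>

lemma not_on_axis:
  assumes C0: "C = 0" and t1: "t1 \<in> {0..tf}" "Re (z t1) = 0" "Re (l t1) = 0"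
  shows False
proof -
  let ?S = "{t \<in> {0..tf}. Re (z t) = 0 \<and> Re (l t) = 0}"
  have "openin (top_of_set {0..tf}) ?S"
    unfolding openin_euclidean_subtopology_iff using axis_local[OF C0] by fastforce
  moreover have "closedin (top_of_set {0..tf}) ?S"
  proof -
    have "closedin (top_of_set {0..tf}) ({0..tf} \<inter> (\<lambda>t. (Re (z t), Re (l t))) -` {(0, 0)})"
      by (intro continuous_closedin_preimage continuous_intros continuous_z continuous_l)
    moreover have "{0..tf} \<inter> (\<lambda>t. (Re (z t), Re (l t))) -` {(0, 0)} = ?S" by auto
    ultimately show ?thesis by simp
  qed
  ultimately have "?S = {} \<or> ?S = {0..tf}"
    using connected_clopen[of "{0..tf}"] by auto
  then have "Re (z t) = 0" if "t \<in> {0..tf}" for t using t1 that by blast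
  then have "((\<lambda>u. kern1 (z u)) has_integral 0) {0..tf}"
    by (intro has_integral_is_0) (simp add: kern1_def)
  then show False using A A_pos has_integral_unique by blast
qed

section \<open>Zeros of the first adjoint component\<close>

text \<open>\<open>g\<close> plays the partial derivative of \<open>f\<close> in its second
  argument. Where \<open>Re l\<close> vanishes and \<open>l\<close> does not, the velocity is
  vertical and nonzero, so differentiating along the path sees only this partial derivative.\<close>

lemma limit_step:
  assumes E: "E \<subseteq> {t \<in> {0..tf}. Re (l t) = 0 \<and> l t \<noteq> 0}" and t: "t \<in> E" "t islimpt E"
    and 0: "\<And>u. u \<in> E \<Longrightarrow> f (Re (z u)) (Im (z u)) = 0"
    and der: "\<And>X Y y'. (X has_real_derivative 0) (at t within {0..tf}) \<Longrightarrow> (Y has_real_derivative y') (at t within {0..tf}) \<Longrightarrow>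
      ((\<lambda>u. f (X u) (Y u)) has_real_derivative g (X t) (Y t) * y') (at t within {0..tf})"
  shows "g (Re (z t)) (Im (z t)) = 0"
proof -
  have tt: "t \<in> {0..tf}" "Re (l t) = 0" "l t \<noteq> 0" using E t(1) by auto
  have y': "Im (sgn (l t)) \<noteq> 0" using tt by (auto simp: sgn_div_norm complex_eq_iff)
  have "((\<lambda>u. Re (z u)) has_vector_derivative Re (- (v * sgn (l t)))) (at t within {0..tf})"
    "((\<lambda>u. Im (z u)) has_vector_derivative Im (- (v * sgn (l t)))) (at t within {0..tf})"
    by (rule bounded_linear.has_vector_derivative[OF bounded_linear_Re z_derivative[OF tt(1,3)]]
      bounded_linear.has_vector_derivative[OF bounded_linear_Im z_derivative[OF tt(1,3)]])+
  then have "((\<lambda>u. Re (z u)) has_real_derivative 0) (at t within {0..tf})"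
    "((\<lambda>u. Im (z u)) has_real_derivative - (v * Im (sgn (l t)))) (at t within {0..tf})"
    using tt(2) by (simp_all add: has_real_derivative_iff_has_vector_derivative sgn_div_norm ac_simps)
  from der[OF this] have "((\<lambda>u. f (Re (z u)) (Im (z u))) has_vector_derivative
      g (Re (z t)) (Im (z t)) * - (v * Im (sgn (l t)))) (at t within {0..tf})"
    by (simp only: has_real_derivative_iff_has_vector_derivative)
  from vector_derivative_zero_at_limit_of_zeros[OF this t(2)] E t(1) 0
  have "g (Re (z t)) (Im (z t)) * - (v * Im (sgn (l t))) = 0" by blast
  then show ?thesis using y' v by simp
qed

text \<open>At all but countably many points of the set below, every derivative of \<open>Re l\<close> vanishes.
  There \<open>Re z\<close> is stationary, so this makes the cubic form in \<open>Re_lagr_grad\<close> and its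
  derivatives in the second variable vanish at a common point.\<close>
lemma countable_Re_l_zeros: "countable {t \<in> {0..tf}. Re (l t) = 0 \<and> l t \<noteq> 0}" (is "countable ?E")
proof (rule ccontr)
  assume unc: "uncountable ?E"
  \<comment> \<open>Discarding isolated points preserves uncountability but may create new ones, so
    it is iterated: once for \<open>Re l\<close> and three times for the cubic form.\<close>
  define lim where "lim E = {t \<in> E. t islimpt E}" for E :: "real set"
  have lim: "uncountable (lim E)" if "uncountable E" for E
  proof
    assume "countable (lim E)"
    then have "countable (lim E \<union> {t \<in> E. \<not> t islimpt E})"
      using countable_isolated_points by (intro countable_Un)
    moreover have "lim E \<union> {t \<in> E. \<not> t islimpt E} = E" by (auto simp: lim_def)
    ultimately show False using that by simp
  qed
  have sub: "lim E \<subseteq> E" and limD: "t \<in> lim E \<Longrightarrow> t \<in> E" "t \<in> lim E \<Longrightarrow> t islimpt E" for E t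
    by (auto simp: lim_def)
  \<comment> \<open>The cubic form followed by its successive derivatives in
    \<open>y\<close>.\<close>
  let ?P0 = "\<lambda>x y. - B * x ^ 3 + 3 * C * x\<^sup>2 * y + (B - 2 * A) * x * y\<^sup>2 - C * y ^ 3"
  let ?P1 = "\<lambda>x y. 3 * C * x\<^sup>2 + 2 * (B - 2 * A) * x * y - 3 * C * y\<^sup>2"
  let ?P2 = "\<lambda>x y. 2 * (B - 2 * A) * x - 6 * C * y"
  let ?P3 = "\<lambda>x y. - 6 * C"
  let ?E1 = "lim ?E" let ?E2 = "lim ?E1" let ?E3 = "lim ?E2" let ?E4 = "lim ?E3"
  have s1: "?E1 \<subseteq> ?E" and s2: "?E2 \<subseteq> ?E" and s3: "?E3 \<subseteq> ?E" and s4: "?E4 \<subseteq> ?E"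
    using sub by blast+
  have e1: "?P0 (Re (z t)) (Im (z t)) = 0" if t: "t \<in> ?E1" for t
  proof -
    have tt: "t \<in> {0..tf}" "Re (l t) = 0" "t islimpt ?E" using t by (auto simp: lim_def)
    have "((\<lambda>u. Re (l u)) has_vector_derivative Re (- lagr_grad A B C (z t))) (at t within {0..tf})"
      by (rule bounded_linear.has_vector_derivative[OF bounded_linear_Re l_derivative[OF tt(1)]])
    then have "Re (- lagr_grad A B C (z t)) = 0"
      by (rule vector_derivative_zero_at_limit_of_zeros[where f = "\<lambda>u. Re (l u)", OF _ tt(3) _ tt(2)]) auto
    then have "Re (lagr_grad A B C (z t)) = 0" by simp
    then show ?thesis using z_nonzero[OF tt(1)] unfolding Re_lagr_grad by simp
  qed
  have e2: "?P1 (Re (z t)) (Im (z t)) = 0" if t: "t \<in> ?E2" for t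
  proof (rule limit_step[where f = ?P0 and g = ?P1, OF s1 _ _ e1])
    show "t \<in> ?E1" "t islimpt ?E1" using limD[OF t] by blast+
  qed (auto intro!: derivative_eq_intros simp: power2_eq_square algebra_simps)
  have e3: "?P2 (Re (z t)) (Im (z t)) = 0" if t: "t \<in> ?E3" for t
  proof (rule limit_step[where f = ?P1 and g = ?P2, OF s2 _ _ e2])
    show "t \<in> ?E2" "t islimpt ?E2" using limD[OF t] by blast+
  qed (auto intro!: derivative_eq_intros simp: power2_eq_square algebra_simps)
  have e4: "?P3 (Re (z t)) (Im (z t)) = 0" if t: "t \<in> ?E4" for t
  proof (rule limit_step[where f = ?P2 and g = ?P3, OF s3 _ _ e3])
    show "t \<in> ?E3" "t islimpt ?E3" using limD[OF t] by blast+
  qed (auto intro!: derivative_eq_intros simp: power2_eq_square algebra_simps)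
  have "uncountable ?E4" using unc by (intro lim)
  then obtain t where t: "t \<in> ?E4" by (metis countable_empty ex_in_conv)
  have t': "t \<in> ?E3" "t \<in> ?E1" using t sub by blast+
  have C0: "C = 0" using e4[OF t] by simp
  \<comment> \<open>With \<open>C = 0\<close> this removes the mixed term of the cubic form as well
    and leaves only \<open>- B * x ^ 3\<close>.\<close>
  have "(B - 2 * A) * Re (z t) = 0" using e3[OF t'(1)] C0 by simp
  then have "B * (Re (z t)) ^ 3 = 0"
    using e1[OF t'(2)] C0 by (cases "Re (z t) = 0") auto
  then have "Re (z t) = 0" using B_pos by simp
  then show False using not_on_axis[OF C0] s4 t by blast
qed

text \<open>The tangent of the angle is the same for \<open>l\<close> and for its opposite, so the
  direction \<open>- sgn (l t)\<close> determines the angle by its tangent up to a multiple of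
  pi.\<close>

theorem control_formula:
  "AE t in lebesgue_on {0..tf}. Re (l t) \<noteq> 0 \<and>
    (\<exists>k::int. th t = arctan (Im (l t) / Re (l t)) + of_int k * pi)"
proof -
  obtain N where N: "negligible N" "\<And>t. t \<in> {0..tf} - N \<Longrightarrow> cis (th t) = - sgn (l t) \<and> l t \<noteq> 0"
    by (rule control_direction) blast
  have "negligible (N \<union> {t \<in> {0..tf}. Re (l t) = 0 \<and> l t \<noteq> 0})"
    by (rule negligible_Un[OF N(1) countable_imp_negligible[OF countable_Re_l_zeros]])
  moreover have "Re (l t) \<noteq> 0 \<and> (\<exists>k::int. th t = arctan (Im (l t) / Re (l t)) + of_int k * pi)"
    if t: "t \<in> {0..tf}" "t \<notin> N \<union> {t \<in> {0..tf}. Re (l t) = 0 \<and> l t \<noteq> 0}" for t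
  proof -
    have cis: "cis (th t) = - sgn (l t)" "l t \<noteq> 0" using N(2) t by auto
    then have R: "Re (l t) \<noteq> 0" using t by blast
    have "cos (th t) = - (Re (l t) / norm (l t))" "sin (th t) = - (Im (l t) / norm (l t))"
      using arg_cong[OF cis(1), of Re] arg_cong[OF cis(1), of Im] by (simp_all add: sgn_div_norm divide_inverse)
    then have "cos (th t) \<noteq> 0" "tan (th t) = Im (l t) / Re (l t)"
      using R cis(2) by (simp_all add: tan_def)
    then show ?thesis using eq_arctan_tan_plus_pi_multiple[of "th t"] R by simp
  qed
  ultimately show ?thesis
    unfolding AE_lebesgue_on_iff_negligible[OF lmeasurable_interval(1)[THEN fmeasurableD]]
    by (elim negligible_subset) blast
qed

end

theorem proposition3:
  fixes v tf x0 y0 :: real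
    and s p :: "real \<Rightarrow> real^5"
    and \<theta> :: "real \<Rightarrow> real"
  assumes "v > 0" and "tf > 0"
    and "optimal_pair v tf x0 y0 s \<theta>"
    and "is_adjoint v tf s \<theta> p"
  shows "AE t in lebesgue_on {0..tf}.
           p t $ 1 \<noteq> 0 \<and>
           (\<exists>k::int. \<theta> t = arctan (p t $ 2 / p t $ 1) + of_int k * pi)"
proof -
  have feas: "feasible v tf x0 y0 s \<theta>"
    and opt: "\<And>s' \<theta>'. feasible v tf x0 y0 s' \<theta>' \<Longrightarrow> terminal_cost (s tf) \<le> terminal_cost (s' tf)"
    using assms(3) by (auto simp: optimal_pair_def)
  note F = feasibleD[OF feas]
  \<comment> \<open>Feasibility gives a nonzero final value of z1 or z2, and the adjoint equation
    then excludes the origin.\<close>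
  have nz: "pos (s t) \<noteq> 0" if "t \<in> {0..tf}" for t
    using adjointD(2)[OF assms(4,2) that feasible_nondegenerate[OF feas assms(1,2)]] .
  have s0: "pos (s 0) = Complex x0 y0"
    using F(3)[of 0] assms(2) by (simp add: has_integral_iff)
  interpret extremal v tf "s tf $ 3" "s tf $ 4" "s tf $ 5" "\<lambda>t. pos (s t)" "\<lambda>t. pos (p t)" \<theta>
  proof
    fix th' z'
    assume th': "th' \<in> borel_measurable (lebesgue_on {0..tf})" "integrable (lebesgue_on {0..tf}) (\<lambda>t. (th' t)\<^sup>2)"
      and z': "\<And>t. t \<in> {0..tf} \<Longrightarrow> ((\<lambda>u. v * cis (th' u)) has_integral z' t - pos (s 0)) {0..t}"
        "\<And>t. t \<in> {0..tf} \<Longrightarrow> z' t \<noteq> 0"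
    have "feasible v tf x0 y0 (\<lambda>t. vector [Re (z' t), Im (z' t), integral {0..t} (\<lambda>u. kern1 (z' u)),
      integral {0..t} (\<lambda>u. kern2 (z' u)), integral {0..t} (\<lambda>u. kern3 (z' u))]) th'"
      using assms(2) by (intro feasibleI th' z'[unfolded s0]) auto
    from opt[OF this] show "(s tf $ 5)\<^sup>2 - s tf $ 3 * s tf $ 4 \<le> (integral {0..tf} (\<lambda>u. kern3 (z' u)))\<^sup>2
        - integral {0..tf} (\<lambda>u. kern1 (z' u)) * integral {0..tf} (\<lambda>u. kern2 (z' u))"
      by (simp add: terminal_cost_def)
  next
    show "pos (p tf) = 0" by (rule adjointD(1)[OF assms(4,2)])
  qed (use assms(1,2) F nz s0 adjointD(3)[OF assms(4,2)] in auto)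
  show ?thesis using control_formula by (simp add: pos_def)
qed

end
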